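(* Let $j \geq 0$ be a fixed integer and assume $\alpha > 0$. Then there is a (strictly) positive random variable $\gamma_j$ such that, in the $N$-interactions model, $$W[n,j] \sim \frac{1}{\Gamma(1+\alpha)}\,\gamma_j\, n^{\alpha}\qquad\text{almost surely as } n\to\infty .$$
   Context: The $N$-interactions model. Fix an integer $N\ge 3$ and parameters $0<p\le 1$, $q,r\in[0,1]$. An $m$-clique is a complete graph on $m$ vertices, $K_m$. At time $n=0$ the graph is a single $K_N$; this graph and all of its cliques (in particular its vertices, its $(N-1)$-cliques and the $N$-clique itself) have initial weight $1$. At each step $n=1,2,\dots$ a set of $N$ vertices interacts: all non-existing edges between them are drawn, so that they form a $K_N$, and the weights of this $K_N$ and of all cliques contained in it are increased by $1$ (a clique that was never contained in the initial or an interacting $K_N$ has weight $0$). The $N$ interacting vertices are chosen, given the past, as follows. - With probability $p$ a new vertex is added, and it interacts with $N-1$ old vertices. With probability $r$ these are the vertices of an $(N-1)$-clique chosen from the existing $(N-1)$-cliques with probability proportional to weight (a clique of weight $w_t$ is chosen with probability $w_t/\sum_h w_h$); with probability $1-r$ they are a uniformly chosen $(N-1)$-element subset of the existing vertices. - With probability $1-p$ no new vertex is added and $N$ old vertices interact. With probability $q$ these are the vertices of an $N$-clique chosen from the existing $N$-cliques with probability proportional to weight; with probability $1-q$ they are a uniformly chosen $N$-element subset of the existing vertices. Constants: $\alpha=(1-p)q+\frac{N-1}{N}pr$. Labels: one of the $N$ initial vertices (fixed in advance) is labelled $0$; new vertices are labelled $1,2,\dots$ in the order in which they are added. $W[n,j]$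 is the weight of the vertex labelled $j$ after the $n$th step, with $W[n,j]=0$ if this vertex does not yet exist after $n$ steps. $\Gamma$ is the Gamma function. *)

theory Defs
  imports "HOL-Probability.Probability" "HOL-Library.Landau_Symbols"
begin

text \<open>
  The vertices carrying a label \<open>j\<close> are \<open>Lab j\<close>; the remaining \<open>N - 1\<close> initial vertices, which
  have no label, are \<open>Anon 0, \<dots>, Anon (N - 2)\<close>.
\<close>

datatype vertex = Lab nat | Anon nat

record state =
  verts :: "vertex set"
  edges :: "vertex set set"
  weight :: "vertex set \<Rightarrow> nat"

definition cliques :: "nat \<Rightarrow> state \<Rightarrow> vertex set set" where
  "cliques m g =
     {C. C \<subseteq> verts g \<and> finite C \<and> card C = m \<and> (\<forall>e. e \<subseteq> C \<and> card e = 2 \<longrightarrow> e \<in> edges g)}"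

definition initial_verts :: "nat \<Rightarrow> vertex set" where
  "initial_verts N = insert (Lab 0) (Anon ` {..<N - 1})"

definition initial_state :: "nat \<Rightarrow> state" where
  "initial_state N =
     \<lparr>verts = initial_verts N,
      edges = {e. e \<subseteq> initial_verts N \<and> card e = 2},
      weight = (\<lambda>C. if C \<noteq> {} \<and> C \<subseteq> initial_verts N then 1 else 0)\<rparr>"

definition interact :: "vertex set \<Rightarrow> state \<Rightarrow> state" where
  "interact A g =
     \<lparr>verts = verts g \<union> A,
      edges = edges g \<union> {e. e \<subseteq> A \<and> card e = 2},
      weight = (\<lambda>C. if C \<noteq> {} \<and> C \<subseteq> A then weight g C + 1 else weight g C)\<rparr>"

definition new_vertex :: "state \<Rightarrow> vertex" where
  "new_vertex g = Lab (LEAST k. Lab k \<notin> verts g)"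

definition proportional_pmf :: "('a \<Rightarrow> nat) \<Rightarrow> 'a set \<Rightarrow> 'a pmf" where
  "proportional_pmf w S =
     embed_pmf (\<lambda>x. if x \<in> S then real (w x) / (\<Sum>h\<in>S. real (w h)) else 0)"

text \<open>
  \<^const>\<open>embed_pmf\<close> is meaningful only for functions that sum to one; here this amounts to
  a positive total weight.
\<close>

lemma pmf_proportional_pmf:
  assumes "finite S" and "(\<Sum>h\<in>S. real (w h)) > 0"
  shows "pmf (proportional_pmf w S) x = (if x \<in> S then real (w x) / (\<Sum>h\<in>S. real (w h)) else 0)"
proof -
  let ?f = "\<lambda>x. if x \<in> S then real (w x) / (\<Sum>h\<in>S. real (w h)) else 0"
  have nn: "0 \<le> ?f x" for x
    using assms(2) by simp
  have "(\<integral>\<^sup>+x. ennreal (?f x) \<partial>count_space UNIV) = (\<Sum>x\<in>S. ennreal (?f x))"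
    using assms(1) by (intro nn_integral_count_space') auto
  also have "\<dots> = ennreal (\<Sum>x\<in>S. ?f x)"
    by (rule sum_ennreal) (rule nn)
  also have "(\<Sum>x\<in>S. ?f x) = 1"
    using assms by (simp flip: sum_divide_distrib)
  finally show ?thesis
    unfolding proportional_pmf_def using nn by (subst pmf_embed_pmf) auto
qed

definition uniform_subset_pmf :: "nat \<Rightarrow> vertex set \<Rightarrow> vertex set pmf" where
  "uniform_subset_pmf m V = pmf_of_set {A. A \<subseteq> V \<and> card A = m}"

text \<open>The law of the interacting set of \<open>N\<close> vertices in the step following state \<open>g\<close>.\<close>

definition interacting_pmf :: "nat \<Rightarrow> real \<Rightarrow> real \<Rightarrow> real \<Rightarrow> state \<Rightarrow> vertex set pmf" where
  "interacting_pmf N p q r g =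
     do {
       new \<leftarrow> bernoulli_pmf p;
       if new then do {
         by_weight \<leftarrow> bernoulli_pmf r;
         A \<leftarrow> (if by_weight then proportional_pmf (weight g) (cliques (N - 1) g)
              else uniform_subset_pmf (N - 1) (verts g));
         return_pmf (insert (new_vertex g) A)
       }
       else do {
         by_weight \<leftarrow> bernoulli_pmf q;
         (if by_weight then proportional_pmf (weight g) (cliques N g)
          else uniform_subset_pmf N (verts g))
       }
     }"

text \<open>
  \<open>state_after N a n\<close> is the state after \<open>n\<close> steps when \<open>a k\<close> is the interacting set of step
  \<open>k\<close>, for \<open>k = 1, 2, \<dots>\<close>; the value \<open>a 0\<close> is irrelevant.
\<close>

fun state_after :: "nat \<Rightarrow> (nat \<Rightarrow> vertex set) \<Rightarrow> nat \<Rightarrow> state" where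
  "state_after N a 0 = initial_state N"
| "state_after N a (Suc n) = interact (a (Suc n)) (state_after N a n)"

text \<open>
  \<open>I n \<omega>\<close> is the set of vertices interacting at step \<open>n \<ge> 1\<close>. As the state after \<open>n\<close> steps is a
  function of \<open>I 1, \<dots>, I n\<close>, conditioning on the past means conditioning on these; they
  take values in a countable set, so elementary conditional probabilities suffice.
\<close>

locale N_interactions_model = prob_space M for M :: "'a measure" +
  fixes N :: nat and p q r :: real and I :: "nat \<Rightarrow> 'a \<Rightarrow> vertex set"
  assumes N_ge_3: "N \<ge> 3"
    and p_pos: "0 < p" and p_le_1: "p \<le> 1"
    and q_nonneg: "0 \<le> q" and q_le_1: "q \<le> 1"
    and r_nonneg: "0 \<le> r" and r_le_1: "r \<le> 1"
    and I_measurable: "\<And>n. n \<ge> 1 \<Longrightarrow> I n \<in> M \<rightarrow>\<^sub>M count_space {A. finite A}"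
    and I_step: "\<And>n a. \<P>(\<omega> in M. \<forall>k\<in>{1..n}. I k \<omega> = a k) > 0 \<Longrightarrow>
      \<P>(\<omega> in M. I (Suc n) \<omega> = a (Suc n) \<bar> \<forall>k\<in>{1..n}. I k \<omega> = a k)
        = pmf (interacting_pmf N p q r (state_after N a n)) (a (Suc n))"

definition interaction_alpha :: "nat \<Rightarrow> real \<Rightarrow> real \<Rightarrow> real \<Rightarrow> real" where
  "interaction_alpha N p q r = (1 - p) * q + (real N - 1) / real N * p * r"

text \<open>
  This is \<open>W[n,j]\<close>. The weight of a set that was never contained in an interacting clique is \<open>0\<close>,
  so the value is \<open>0\<close> as long as the vertex labelled \<open>j\<close> does not exist.
\<close>

definition vertex_weight :: "nat \<Rightarrow> (nat \<Rightarrow> 'a \<Rightarrow> vertex set) \<Rightarrow> nat \<Rightarrow> nat \<Rightarrow> 'a \<Rightarrow> nat" where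
  "vertex_weight N I n j \<omega> = weight (state_after N (\<lambda>k. I k \<omega>) n) {Lab j}"

end

theory Submission
  imports Defs
begin

text \<open>
  Let \<open>W\<close> be the weight of the vertex, \<open>D\<close> its increment in the next step and \<open>\<pi>\<close> the conditional
  probability of \<open>D = 1\<close>. Counting cliques inside each interacting set gives
  \<open>\<pi> = \<alpha> W / (n + 1) + \<beta> / V\<close> with \<open>V\<close> the number of vertices, so \<open>ln W\<close> grows on average like
  \<open>\<alpha> ln n\<close>, and the claim is that \<open>ln W - \<alpha> ln n\<close> converges. The martingale part has increments
  \<open>ln (1 + 1 / W) (D - \<pi>)\<close>, whose conditional variance is at most \<open>\<pi> / W\<^sup>2\<close>. Since \<open>\<Sum> D / W\<^sup>2\<close> is at
  most \<open>\<Sum> 1 / w\<^sup>2\<close> along every path, \<open>\<Sum> E (\<pi> / W\<^sup>2)\<close> is finite, so this martingale is bounded in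
  \<open>L\<^sup>2\<close> without any information on the growth of \<open>W\<close>. As \<open>\<pi> \<ge> \<alpha> W / (n + 1)\<close>, the same bound shows
  that \<open>\<Sum> 1 / ((n + 1) W)\<close> is almost surely finite; together with a linear lower bound for \<open>V\<close>
  this makes the drift \<open>\<pi> ln (1 + 1 / W) - \<alpha> / (n + 1)\<close> absolutely summable.
\<close>

section \<open>Martingales bounded in \<open>L\<^sup>2\<close>\<close>

text \<open>
  As in Kolmogorov's inequality, the sums stopped when they first leave the interval of radius
  \<open>\<epsilon>\<close> have orthogonal increments, so their second moment is at most the sum of the variances.
\<close>

lemma (in prob_space) martingale_maximal_inequality:
  fixes \<xi> :: "nat \<Rightarrow> 'a \<Rightarrow> real" and F :: "nat \<Rightarrow> 'a measure"
  assumes sub: "\<And>n. subalgebra M (F n)"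
    and mono: "\<And>m n. m \<le> n \<Longrightarrow> subalgebra (F n) (F m)"
    and adapted: "\<And>n. \<xi> n \<in> borel_measurable (F (Suc n))"
    and bounded: "\<And>n \<omega>. \<bar>\<xi> n \<omega>\<bar> \<le> C"
    and mart: "\<And>n. AE \<omega> in M. real_cond_exp M (F n) (\<xi> n) \<omega> = 0"
    and "\<epsilon> > 0"
  shows "prob {\<omega>\<in>space M. \<exists>i\<in>{m..n}. \<bar>\<Sum>k=m..<i. \<xi> k \<omega>\<bar> > \<epsilon>} \<le>
           (\<Sum>k=m..<n. expectation (\<lambda>\<omega>. (\<xi> k \<omega>)\<^sup>2)) / \<epsilon>\<^sup>2"
proof -
  \<comment> \<open>Indicator that no partial sum started at \<open>m\<close> has left the interval
    by time \<open>k\<close>. It involves only the \<open>\<xi> i\<close> with \<open>i < k\<close>,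
    so it is known before \<open>\<xi> k\<close> is revealed.\<close>
  define T where "T k \<omega> = (of_bool (\<forall>i\<in>{m..k}. \<bar>\<Sum>k=m..<i. \<xi> k \<omega>\<bar> \<le> \<epsilon>) :: real)" for k \<omega>
  define S where "S i \<omega> = (\<Sum>k=m..<i. T k \<omega> * \<xi> k \<omega>)" for i \<omega>
  have adapted': "\<xi> k \<in> borel_measurable (F i)" if "k < i" for k i
    using measurable_from_subalg[OF mono adapted] that by (simp add: Suc_le_eq)
  have meas [measurable]: "\<xi> k \<in> borel_measurable M" for k
    using measurable_from_subalg[OF sub adapted] .
  have T_F: "T k \<in> borel_measurable (F k)" for k
  proof -
    note [measurable] = adapted'
    have [measurable]: "(\<lambda>\<omega>. \<Sum>k=m..<i. \<xi> k \<omega>) \<in> borel_measurable (F k)" if "i \<le> k" for i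
      using that by (intro borel_measurable_sum adapted') auto
    show ?thesis unfolding T_def by measurable
  qed
  have S_F: "S i \<in> borel_measurable (F i)" for i
    unfolding S_def using measurable_from_subalg[OF mono T_F]
    by (intro borel_measurable_sum borel_measurable_times adapted') auto
  have [measurable]: "T k \<in> borel_measurable M" "S k \<in> borel_measurable M" for k
    using measurable_from_subalg[OF sub T_F] measurable_from_subalg[OF sub S_F] by auto
  have T01: "T k \<omega> = 0 \<or> T k \<omega> = 1" for k \<omega> by (simp add: T_def of_bool_def)
  have T_bound: "\<bar>T k \<omega>\<bar> \<le> 1" for k \<omega> using T01[of k \<omega>] by auto
  have C0: "0 \<le> C" using bounded[of 0 undefined] by linarith
  have term_bound: "\<bar>T k \<omega> * \<xi> k \<omega>\<bar> \<le> C" for k \<omega>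
    unfolding abs_mult using mult_mono[OF T_bound[of k \<omega>] bounded[of k \<omega>]] by simp
  have S_bound: "\<bar>S i \<omega>\<bar> \<le> real i * C" for i \<omega>
  proof -
    have "\<bar>S i \<omega>\<bar> \<le> (\<Sum>k=m..<i. C)"
      unfolding S_def by (rule order_trans[OF sum_abs]) (intro sum_mono term_bound)
    also have "\<dots> \<le> real i * C" using C0 by (simp add: mult_right_mono)
    finally show ?thesis .
  qed
  have S_int: "integrable M (\<lambda>\<omega>. (S i \<omega>)\<^sup>2)" for i
  proof (rule integrable_const_bound[where B = "(real i * C)\<^sup>2"])
    show "AE \<omega> in M. norm ((S i \<omega>)\<^sup>2) \<le> (real i * C)\<^sup>2"
      using power_mono[OF S_bound, of i _ 2] by simp
  qed simp
  have xi_int: "integrable M (\<lambda>\<omega>. (\<xi> k \<omega>)\<^sup>2)" for k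
  proof (rule integrable_const_bound[where B = "C\<^sup>2"])
    show "AE \<omega> in M. norm ((\<xi> k \<omega>)\<^sup>2) \<le> C\<^sup>2"
      using power_mono[OF bounded, of k _ 2] by simp
  qed simp
  have second_moment: "expectation (\<lambda>\<omega>. (S i \<omega>)\<^sup>2) \<le> (\<Sum>k=m..<i. expectation (\<lambda>\<omega>. (\<xi> k \<omega>)\<^sup>2))"
    if "m \<le> i" for i
    using that
  proof (induction i rule: dec_induct)
    case base
    show ?case by (simp add: S_def)
  next
    case (step i)
    interpret finite_measure_subalgebra M "F i" by unfold_locales (rule sub)
    \<comment> \<open>Weight of the cross term in the expanded square. It is
      \<open>F i\<close>-measurable, so conditioning replaces \<open>\<xi> i\<close> by 0.\<close>
    let ?f = "\<lambda>\<omega>. 2 * S i \<omega> * T i \<omega>"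
    have f_bound: "\<bar>?f \<omega> * \<xi> i \<omega>\<bar> \<le> 2 * (real i * C * C)" for \<omega>
      using mult_mono[OF S_bound[of i \<omega>] term_bound[of i \<omega>]] C0 by (simp add: abs_mult mult.assoc)
    have int: "integrable M (\<lambda>\<omega>. ?f \<omega> * \<xi> i \<omega>)"
      by (rule integrable_const_bound[where B = "2 * (real i * C * C)"]) (use f_bound in auto)
    have "expectation (\<lambda>\<omega>. ?f \<omega> * \<xi> i \<omega>) = expectation (\<lambda>\<omega>. ?f \<omega> * real_cond_exp M (F i) (\<xi> i) \<omega>)"
      using S_F T_F by (intro real_cond_exp_intg(2)[symmetric] int) auto
    also have "\<dots> = expectation (\<lambda>_. 0)"
      using mart[of i] S_F T_F by (intro integral_cong_AE) auto
    finally have cross: "expectation (\<lambda>\<omega>. ?f \<omega> * \<xi> i \<omega>) = 0" by simp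
    have "expectation (\<lambda>\<omega>. (S (Suc i) \<omega>)\<^sup>2) \<le>
        expectation (\<lambda>\<omega>. (S i \<omega>)\<^sup>2 + ?f \<omega> * \<xi> i \<omega> + (\<xi> i \<omega>)\<^sup>2)"
    proof (rule integral_mono)
      show "integrable M (\<lambda>\<omega>. (S i \<omega>)\<^sup>2 + ?f \<omega> * \<xi> i \<omega> + (\<xi> i \<omega>)\<^sup>2)"
        by (intro Bochner_Integration.integrable_add S_int xi_int int)
      \<comment> \<open>Equality while the sum is running; once it is stopped, the left side merely
        lacks the square of \<open>\<xi> i\<close>.\<close>
      show "(S (Suc i) \<omega>)\<^sup>2 \<le> (S i \<omega>)\<^sup>2 + ?f \<omega> * \<xi> i \<omega> + (\<xi> i \<omega>)\<^sup>2" for \<omega>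
        using T01[of i \<omega>] step.hyps
        by (auto simp: S_def power2_eq_square algebra_simps)
    qed (rule S_int)
    also have "\<dots> = expectation (\<lambda>\<omega>. (S i \<omega>)\<^sup>2) + expectation (\<lambda>\<omega>. (\<xi> i \<omega>)\<^sup>2)"
      using S_int[of i] xi_int[of i] int cross by simp
    finally show ?case using step.IH step.hyps by simp
  qed
  show ?thesis
  proof (cases "m \<le> n")
    case True
    let ?A = "{\<omega>\<in>space M. \<exists>i\<in>{m..n}. \<bar>\<Sum>k=m..<i. \<xi> k \<omega>\<bar> > \<epsilon>}"
    have "?A \<subseteq> {\<omega>\<in>space M. \<epsilon>\<^sup>2 \<le> (S n \<omega>)\<^sup>2}"
    proof clarify
      fix \<omega> i assume "\<omega> \<in> space M" "i \<in> {m..n}" "\<bar>\<Sum>k=m..<i. \<xi> k \<omega>\<bar> > \<epsilon>"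
      \<comment> \<open>The first exit time. The stopped sum freezes at the value that left the
        interval, so \<open>S n\<close> still exceeds \<epsilon> in modulus.\<close>
      define j where "j = (LEAST i. m \<le> i \<and> \<bar>\<Sum>k=m..<i. \<xi> k \<omega>\<bar> > \<epsilon>)"
      have ex: "m \<le> i \<and> \<bar>\<Sum>k=m..<i. \<xi> k \<omega>\<bar> > \<epsilon>" using \<open>i \<in> {m..n}\<close> \<open>\<bar>\<Sum>k=m..<i. \<xi> k \<omega>\<bar> > \<epsilon>\<close> by simp
      have j: "m \<le> j" "\<bar>\<Sum>k=m..<j. \<xi> k \<omega>\<bar> > \<epsilon>" "j \<le> i"
        using LeastI[of "\<lambda>i. m \<le> i \<and> \<bar>\<Sum>k=m..<i. \<xi> k \<omega>\<bar> > \<epsilon>", OF ex]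
          Least_le[of "\<lambda>i. m \<le> i \<and> \<bar>\<Sum>k=m..<i. \<xi> k \<omega>\<bar> > \<epsilon>", OF ex] by (auto simp: j_def)
      have small: "\<bar>\<Sum>k=m..<i. \<xi> k \<omega>\<bar> \<le> \<epsilon>" if "m \<le> i" "i < j" for i
        using not_less_Least[of i "\<lambda>i. m \<le> i \<and> \<bar>\<Sum>k=m..<i. \<xi> k \<omega>\<bar> > \<epsilon>"] that by (auto simp: j_def)
      have T: "T k \<omega> = of_bool (k < j)" if "m \<le> k" for k
        unfolding T_def of_bool_eq_iff using j(1,2) small that
        by (meson atLeastAtMost_iff not_less order.strict_trans1)
      have "S n \<omega> = (\<Sum>k\<in>{m..<n}. if k \<in> {m..<j} then \<xi> k \<omega> else 0)"
        unfolding S_def by (intro sum.cong refl) (auto simp: T)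
      also have "\<dots> = (\<Sum>k\<in>{m..<n} \<inter> {m..<j}. \<xi> k \<omega>)"
        by (rule sum.inter_restrict[symmetric]) simp
      also have "{m..<n} \<inter> {m..<j} = {m..<j}"
        using j(3) \<open>i \<in> {m..n}\<close> by auto
      finally show "\<epsilon>\<^sup>2 \<le> (S n \<omega>)\<^sup>2"
        using j(2) \<open>\<epsilon> > 0\<close> by (metis less_eq_real_def power2_abs power_mono)
    qed
    then have "prob ?A \<le> prob {\<omega>\<in>space M. \<epsilon>\<^sup>2 \<le> (S n \<omega>)\<^sup>2}"
      by (rule finite_measure_mono) measurable
    also have "\<dots> \<le> expectation (\<lambda>\<omega>. (S n \<omega>)\<^sup>2) / \<epsilon>\<^sup>2"
      using \<open>\<epsilon> > 0\<close> by (intro integral_Markov_inequality_measure[OF S_int, of "{}"]) auto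
    also have "\<dots> \<le> (\<Sum>k=m..<n. expectation (\<lambda>\<omega>. (\<xi> k \<omega>)\<^sup>2)) / \<epsilon>\<^sup>2"
      using second_moment[OF True] by (simp add: divide_right_mono)
    finally show ?thesis .
  qed (simp add: sum_nonneg)
qed

text \<open>The maximal inequality bounds the chance of ever leaving an interval after time
  \<open>m\<close> by a tail of the variance series. These tails tend to 0, so almost surely every
  radius has a starting point after which no exit occurs, which is the Cauchy criterion.\<close>

theorem (in prob_space) martingale_differences_summable:
  fixes \<xi> :: "nat \<Rightarrow> 'a \<Rightarrow> real" and F :: "nat \<Rightarrow> 'a measure"
  assumes sub: "\<And>n. subalgebra M (F n)"
    and mono: "\<And>m n. m \<le> n \<Longrightarrow> subalgebra (F n) (F m)"
    and adapted: "\<And>n. \<xi> n \<in> borel_measurable (F (Suc n))"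
    and bounded: "\<And>n \<omega>. \<bar>\<xi> n \<omega>\<bar> \<le> C"
    and mart: "\<And>n. AE \<omega> in M. real_cond_exp M (F n) (\<xi> n) \<omega> = 0"
    and variances: "summable (\<lambda>n. expectation (\<lambda>\<omega>. (\<xi> n \<omega>)\<^sup>2))"
  shows "AE \<omega> in M. summable (\<lambda>n. \<xi> n \<omega>)"
proof -
  have meas [measurable]: "\<xi> k \<in> borel_measurable M" for k
    using measurable_from_subalg[OF sub adapted] .
  define v where "v n = expectation (\<lambda>\<omega>. (\<xi> n \<omega>)\<^sup>2)" for n
  have v: "summable v" "\<And>n. v n \<ge> 0" using variances by (auto simp: v_def[abs_def])
  define B where "B e m = {\<omega>\<in>space M. \<exists>i\<ge>m. \<bar>\<Sum>k=m..<i. \<xi> k \<omega>\<bar> > e}" for e m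
  have [measurable]: "B e m \<in> sets M" for e m unfolding B_def by measurable
  have B_le: "prob (B e m) \<le> (\<Sum>k. v (k + m)) / e\<^sup>2" if "e > 0" for e m
  proof (rule LIMSEQ_le_const2)
    let ?B = "\<lambda>n. {\<omega>\<in>space M. \<exists>i\<in>{m..n}. \<bar>\<Sum>k=m..<i. \<xi> k \<omega>\<bar> > e}"
    have "(\<lambda>n. prob (?B n)) \<longlonglongrightarrow> prob (\<Union>n. ?B n)"
      by (rule finite_Lim_measure_incseq) (auto simp: incseq_def, measurable)
    also have "(\<Union>n. ?B n) = B e m" unfolding B_def by fastforce
    finally show "(\<lambda>n. prob (?B n)) \<longlonglongrightarrow> prob (B e m)" .
    have "prob (?B n) \<le> (\<Sum>k. v (k + m)) / e\<^sup>2" for n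
    proof -
      have "prob (?B n) \<le> (\<Sum>k=m..<n. v k) / e\<^sup>2"
        unfolding v_def using sub mono adapted bounded mart that
        by (rule martingale_maximal_inequality)
      also have "(\<Sum>k=m..<n. v k) = (\<Sum>k<n-m. v (k + m))"
        by (cases "m \<le> n")
           (simp_all add: sum.shift_bounds_nat_ivl[of v 0 m "n - m", simplified, symmetric] lessThan_atLeast0)
      also have "\<dots> \<le> (\<Sum>k. v (k + m))"
        using v by (intro sum_le_suminf) auto
      finally show ?thesis by (simp add: divide_right_mono)
    qed
    then show "\<exists>N. \<forall>n\<ge>N. prob (?B n) \<le> (\<Sum>k. v (k + m)) / e\<^sup>2" by blast
  qed
  have "AE \<omega> in M. \<exists>m. \<omega> \<notin> B (1 / real (Suc l)) m" for l
  proof -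
    let ?e = "1 / real (Suc l)"
    have "(\<lambda>m. \<Sum>k. v (k + m)) \<longlonglongrightarrow> 0"
      using suminf_exist_split2[OF v(1)] .
    then have lim: "(\<lambda>m. (\<Sum>k. v (k + m)) / ?e\<^sup>2) \<longlonglongrightarrow> 0"
      using tendsto_divide[OF _ tendsto_const[of "?e\<^sup>2"]] by fastforce
    have "prob (\<Inter>m. B ?e m) \<le> (\<Sum>k. v (k + m)) / ?e\<^sup>2" for m
      by (rule order_trans[OF finite_measure_mono B_le]) auto
    then have "prob (\<Inter>m. B ?e m) \<le> 0"
      using LIMSEQ_le_const[OF lim] by blast
    then have "prob (\<Inter>m. B ?e m) = 0"
      using measure_nonneg[of M "\<Inter>m. B ?e m"] by linarith
    moreover have "(\<Inter>m. B ?e m) \<in> sets M" by measurable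
    ultimately have "AE \<omega> in M. \<omega> \<notin> (\<Inter>m. B ?e m)"
      by (simp add: prob_eq_0)
    then show ?thesis by simp
  qed
  then have "AE \<omega> in M. \<forall>l. \<exists>m. \<omega> \<notin> B (1 / real (Suc l)) m"
    by (simp add: AE_all_countable)
  with AE_space show ?thesis
  proof (eventually_elim)
    case (elim \<omega>)
    show ?case
      unfolding summable_Cauchy
    proof (intro allI impI)
      fix e :: real assume "e > 0"
      \<comment> \<open>A block sum is the difference of two sums started at
        \<open>m\<^sub>0\<close>, each below \<open>e / 2\<close> in modulus.\<close>
      then obtain l where l: "1 / real (Suc l) < e / 2" by (meson half_gt_zero nat_approx_posE)
      obtain m\<^sub>0 where m\<^sub>0: "\<omega> \<notin> B (1 / real (Suc l)) m\<^sub>0" using elim(2) by blast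
      have small: "\<bar>\<Sum>k=m\<^sub>0..<i. \<xi> k \<omega>\<bar> < e / 2" if "m\<^sub>0 \<le> i" for i
        using m\<^sub>0 elim(1) that l unfolding B_def
        by force
      have "norm (\<Sum>k=m..<n. \<xi> k \<omega>) < e" if "m\<^sub>0 \<le> m" for m n
      proof (cases "m \<le> n")
        case True
        have "(\<Sum>k=m\<^sub>0..<m. \<xi> k \<omega>) + (\<Sum>k=m..<n. \<xi> k \<omega>) = (\<Sum>k=m\<^sub>0..<n. \<xi> k \<omega>)"
          using that True by (rule sum.atLeastLessThan_concat)
        then show ?thesis using small[of m] small[of n] that True by auto
      qed (use \<open>e > 0\<close> in simp)
      then show "\<exists>N. \<forall>m\<ge>N. \<forall>n. norm (\<Sum>k=m..<n. \<xi> k \<omega>) < e" by blast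
    qed
  qed
qed

text \<open>By monotone convergence the sum has finite expectation, hence is finite almost
  everywhere.\<close>

lemma (in prob_space) AE_summable_of_summable_expectation:
  fixes f :: "nat \<Rightarrow> 'a \<Rightarrow> real"
  assumes int: "\<And>n. integrable M (f n)" and nonneg: "\<And>n \<omega>. 0 \<le> f n \<omega>"
    and sum: "summable (\<lambda>n. expectation (f n))"
  shows "AE \<omega> in M. summable (\<lambda>n. f n \<omega>)"
proof -
  have [measurable]: "f n \<in> borel_measurable M" for n using int by simp
  have "(\<integral>\<^sup>+\<omega>. (\<Sum>n. ennreal (f n \<omega>)) \<partial>M) = (\<Sum>n. ennreal (expectation (f n)))"
    using nonneg by (simp add: nn_integral_suminf nn_integral_eq_integral[OF int])
  also have "\<dots> = ennreal (\<Sum>n. expectation (f n))"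
    using nonneg sum by (intro suminf_ennreal2) auto
  finally have "AE \<omega> in M. (\<Sum>n. ennreal (f n \<omega>)) \<noteq> \<infinity>"
    by (intro nn_integral_noteq_infinite) auto
  then show ?thesis
    by eventually_elim (rule summable_suminf_not_top[OF nonneg], simp)
qed

section \<open>Power laws for counting sequences\<close>

text \<open>The pathwise part of the argument, free of probability. The limit is positive because it
  is obtained as the exponential of a convergent sequence.\<close>

lemma counting_sequence_power_law:
  fixes W V :: "nat \<Rightarrow> nat" and d :: "nat \<Rightarrow> bool" and \<pi> :: "nat \<Rightarrow> real" and \<alpha> \<beta> c :: real
  assumes "\<alpha> > 0" "\<beta> \<ge> 0" "c > 0"
    and W_Suc: "\<And>n. W (Suc n) = W n + of_bool (d n)"
    and W_pos: "eventually (\<lambda>n. W n > 0) sequentially"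
    and V_ge: "eventually (\<lambda>n. real (V n) \<ge> c * real n) sequentially"
    and \<pi>: "\<And>n. W n > 0 \<Longrightarrow> \<pi> n = \<alpha> * (real (W n) / (n + 1)) + \<beta> / V n"
    and sum_mart: "summable (\<lambda>n. ln (1 + 1 / W n) * (of_bool (d n) - \<pi> n))"
    and sum_var: "summable (\<lambda>n. \<pi> n / (real (W n))\<^sup>2)"
  shows "\<exists>L>0. (\<lambda>n. real (W n) / real n powr \<alpha>) \<longlonglongrightarrow> L"
proof -
  let ?\<xi> = "\<lambda>n. ln (1 + 1 / W n) * (of_bool (d n) - \<pi> n)"
  define \<rho> where "\<rho> n = \<pi> n * ln (1 + 1 / W n) - \<alpha> / (n + 1)" for n
  have ev: "eventually (\<lambda>n. W n > 0 \<and> real (V n) \<ge> c * real n \<and> n > 0) sequentially"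
    using W_pos V_ge eventually_gt_at_top[of 0] by eventually_elim simp
  \<comment> \<open>Dropping the nonnegative \<beta> term of \<pi> bounds this series by the
    variance series.\<close>
  have "summable (\<lambda>n. \<alpha> * (1 / ((real n + 1) * W n)))"
  proof (rule summable_comparison_test_ev[OF _ sum_var])
    show "eventually (\<lambda>n. norm (\<alpha> * (1 / ((real n + 1) * W n))) \<le> \<pi> n / (real (W n))\<^sup>2) sequentially"
      using ev
    proof eventually_elim
      case (elim n)
      then have "\<pi> n / (real (W n))\<^sup>2 = \<alpha> * (1 / ((real n + 1) * W n)) + \<beta> / V n / (real (W n))\<^sup>2"
        by (simp add: \<pi> add_divide_distrib power2_eq_square)
      moreover have "\<beta> / V n / (real (W n))\<^sup>2 \<ge> 0" using \<open>\<beta> \<ge> 0\<close> by simp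
      ultimately show ?case using \<open>\<alpha> > 0\<close> by (simp add: abs_mult)
    qed
  qed
  then have sum_inv: "summable (\<lambda>n. 1 / ((real n + 1) * W n))"
    using \<open>\<alpha> > 0\<close> by (subst (asm) summable_cmult_iff) auto
  have "summable \<rho>"
  proof (rule summable_comparison_test_ev)
    \<comment> \<open>The share \<alpha> pays for replacing \<open>w * z\<close> by 1, the share
      \<open>2 * \<beta> / c\<close> for the term with the vertex count.\<close>
    show "summable (\<lambda>n. (\<alpha> + 2 * \<beta> / c) * (1 / ((real n + 1) * W n)))"
      by (rule summable_mult) (rule sum_inv)
    show "eventually (\<lambda>n. norm (\<rho> n) \<le> (\<alpha> + 2 * \<beta> / c) * (1 / ((real n + 1) * W n))) sequentially"
      using ev
    proof eventually_elim
      case (elim n)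
      define w where "w = real (W n)"
      define m where "m = real n + 1"
      define z where "z = ln (1 + 1 / w)"
      have w: "w \<ge> 1" and m: "m > 0" using elim by (auto simp: w_def m_def)
      have z_le: "z \<le> 1 / w" unfolding z_def using w by (intro ln_add_one_self_le_self) auto
      have z_nonneg: "z \<ge> 0" unfolding z_def using w by simp
      \<comment> \<open>The inequality ln x \<le> x - 1 at x = 1 / (1 + 1 / w).\<close>
      have z_ge: "1 / (w + 1) \<le> z"
      proof -
        have "- z = ln (1 / (1 + 1 / w))" unfolding z_def using w by (subst ln_div) (auto simp: add_pos_pos)
        also have "\<dots> \<le> 1 / (1 + 1 / w) - 1" using w by (intro ln_le_minus_one) (auto simp: add_pos_pos)
        also have "\<dots> = - (1 / (w + 1))" using w by (simp add: field_simps)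
        finally show ?thesis by simp
      qed
      have wz_le: "w * z \<le> 1" using z_le w by (simp add: field_simps)
      have "1 - w * z \<le> 1 - w * (1 / (w + 1))" using z_ge w by (intro diff_left_mono mult_left_mono) auto
      also have "\<dots> = 1 / (w + 1)" using w by (simp add: field_simps)
      also have "\<dots> \<le> 1 / w" using w by (simp add: field_simps)
      finally have wz: "\<bar>w * z - 1\<bar> \<le> 1 / w" using wz_le by simp
      \<comment> \<open>The factor 2 comes from n + 1 \<le> 2 n, valid since n > 0.\<close>
      have V: "\<beta> / V n \<le> 2 * \<beta> / c * (1 / m)"
      proof -
        have "m \<le> 2 * real n" using elim by (simp add: m_def)
        then have "c * m / 2 \<le> V n" using elim \<open>c > 0\<close> mult_left_mono[of m "2 * real n" c] by linarith
        then have "\<beta> / V n \<le> \<beta> / (c * m / 2)"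
          using \<open>\<beta> \<ge> 0\<close> \<open>c > 0\<close> m by (intro frac_le) auto
        then show ?thesis by (simp add: field_simps)
      qed
      have "\<rho> n = \<alpha> / m * (w * z - 1) + \<beta> / V n * z"
        using elim by (simp add: \<rho>_def \<pi> w_def m_def z_def algebra_simps diff_divide_distrib)
      also have "\<bar>\<dots>\<bar> \<le> \<alpha> / m * \<bar>w * z - 1\<bar> + \<beta> / V n * z"
        using \<open>\<alpha> > 0\<close> \<open>\<beta> \<ge> 0\<close> m z_nonneg by (intro order_trans[OF abs_triangle_ineq]) (simp add: abs_mult)
      also have "\<dots> \<le> \<alpha> / m * (1 / w) + 2 * \<beta> / c * (1 / m) * (1 / w)"
        using \<open>\<alpha> > 0\<close> \<open>\<beta> \<ge> 0\<close> \<open>c > 0\<close> m z_nonneg wz V z_le w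
        by (intro add_mono mult_mono) auto
      also have "\<dots> = (\<alpha> + 2 * \<beta> / c) * (1 / (m * w))"
        using w m \<open>c > 0\<close> by (simp add: field_simps)
      finally show ?case by (simp add: w_def m_def)
    qed
  qed
  \<comment> \<open>Harmonic numbers make the compensator grow by exactly
    \<open>\<alpha> / (n + 1)\<close>; at the end the Euler-Mascheroni constant trades them for
    logarithms.\<close>
  define s where "s n = ln (real (W n)) - \<alpha> * harm n" for n
  have "eventually (\<lambda>n. s (Suc n) - s n = ?\<xi> n + \<rho> n) sequentially"
    using ev
  proof eventually_elim
    case (elim n)
    have "ln (real (W (Suc n))) - ln (real (W n)) = ln (1 + 1 / W n) * of_bool (d n)"
    proof (cases "d n")
      case True
      then have "real (W (Suc n)) = real (W n) * (1 + 1 / W n)"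
        using elim W_Suc[of n] by (simp add: field_simps)
      moreover have "1 + 1 / real (W n) > 0" by (simp add: add_pos_nonneg)
      ultimately show ?thesis using elim True by (simp add: ln_mult)
    qed (simp add: W_Suc)
    then show ?case by (simp add: s_def \<rho>_def harm_Suc field_simps)
  qed
  moreover have "summable (\<lambda>n. ?\<xi> n + \<rho> n)"
    using sum_mart \<open>summable \<rho>\<close> by (rule summable_add)
  ultimately have "summable (\<lambda>n. s (Suc n) - s n)"
    by (rule summable_cong[THEN iffD2])
  then have "convergent s"
    by (simp add: summable_iff_convergent sum_lessThan_telescope convergent_diff_const_right_iff)
  then obtain S where S: "s \<longlonglongrightarrow> S" by (auto simp: convergent_def)
  have lim: "(\<lambda>n. s n + \<alpha> * (harm n - ln (real n))) \<longlonglongrightarrow> S + \<alpha> * euler_mascheroni"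
    by (intro tendsto_intros S euler_mascheroni_LIMSEQ)
  have "(\<lambda>n. exp (s n + \<alpha> * (harm n - ln (real n)))) \<longlonglongrightarrow> exp (S + \<alpha> * euler_mascheroni)"
    by (intro tendsto_exp lim)
  moreover have "eventually (\<lambda>n. exp (s n + \<alpha> * (harm n - ln (real n))) = real (W n) / real n powr \<alpha>) sequentially"
    using ev
  proof eventually_elim
    case (elim n)
    have "s n + \<alpha> * (harm n - ln (real n)) = ln (real (W n)) - \<alpha> * ln (real n)"
      by (simp add: s_def algebra_simps)
    then show ?case using elim by (simp add: exp_diff powr_def)
  qed
  ultimately have "(\<lambda>n. real (W n) / real n powr \<alpha>) \<longlonglongrightarrow> exp (S + \<alpha> * euler_mascheroni)"
    by (rule Lim_transform_eventually)
  then show ?thesis by (intro exI[of _ "exp (S + \<alpha> * euler_mascheroni)"]) simp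
qed

section \<open>Clique weights in a finite history\<close>

text \<open>The sets avoiding \<open>v\<close> are the subsets of \<open>A - {v}\<close>; Pascal's
  rule evaluates the difference.\<close>

lemma card_subsets_containing:
  assumes "finite A" "card A = k" "m \<ge> 1"
  shows "card {C. C \<subseteq> A \<and> card C = m \<and> v \<in> C} = (if v \<in> A then (k - 1) choose (m - 1) else 0)"
proof (cases "v \<in> A")
  case True
  have "{C. C \<subseteq> A \<and> card C = m \<and> v \<in> C} =
      {C. C \<subseteq> A \<and> card C = m} - {C. C \<subseteq> A - {v} \<and> card C = m}" by auto
  also have "card \<dots> = card {C. C \<subseteq> A \<and> card C = m} - card {C. C \<subseteq> A - {v} \<and> card C = m}"
    using assms(1) by (intro card_Diff_subset) auto
  also have "\<dots> = (k choose m) - ((k - 1) choose m)"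
    using assms True by (simp add: n_subsets)
  also have "\<dots> = (k - 1) choose (m - 1)"
    using assms True by (cases k; cases m) auto
  finally show ?thesis using True by simp
next
  case False
  then have eq: "{C. C \<subseteq> A \<and> card C = m \<and> v \<in> C} = {}" by blast
  show ?thesis unfolding eq using False by simp
qed

text \<open>Absorption identity. It is used with \<open>k = N\<close> for choices by weight and with
  \<open>k\<close> the number of vertices for uniform choices.\<close>

lemma choose_quotient: "m \<ge> 1 \<Longrightarrow> m \<le> k \<Longrightarrow>
    real ((k - 1) choose (m - 1)) / real (k choose m) = real m / real k"
  using times_binomial_minus1_eq[of m k]
  by (simp add: field_simps flip: of_nat_mult)

text \<open>Taking a finite list as argument turns the past into a single discrete value on which
  one can condition.\<close>

definition history_state :: "nat \<Rightarrow> vertex set list \<Rightarrow> state" where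
  "history_state N h = foldl (\<lambda>g A. interact A g) (initial_state N) h"

lemma history_state_snoc: "history_state N (h @ [A]) = interact A (history_state N h)"
  by (simp add: history_state_def)

lemma state_after_eq_history_state:
  "state_after N a n = history_state N (map a [1..<Suc n])"
  by (induction n) (simp_all add: history_state_def)

lemma verts_history_state: "verts (history_state N h) = \<Union>(set (initial_verts N # h))"
  by (induction h rule: rev_induct)
     (auto simp: history_state_snoc interact_def, auto simp: history_state_def initial_state_def)

lemma edges_history_state:
  "edges (history_state N h) = {e. card e = 2 \<and> (\<exists>A\<in>set (initial_verts N # h). e \<subseteq> A)}"
  by (induction h rule: rev_induct)
     (auto simp: history_state_snoc interact_def, auto simp: history_state_def initial_state_def)

text \<open>The initial clique acts like an interaction preceding the history, hence the extended
  list. The empty set is excluded because it keeps weight 0 although every entry contains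
  it.\<close>

lemma weight_history_state:
  assumes "C \<noteq> {}"
  shows "weight (history_state N h) C = (\<Sum>A\<leftarrow>initial_verts N # h. of_bool (C \<subseteq> A))"
  using assms
  by (induction h rule: rev_induct)
     (simp_all add: history_state_snoc interact_def, simp add: history_state_def initial_state_def)

lemma finite_initial_verts: "finite (initial_verts N)"
  by (simp add: initial_verts_def)

lemma card_initial_verts: "N \<ge> 1 \<Longrightarrow> card (initial_verts N) = N"
  unfolding initial_verts_def by (subst card_insert_disjoint) (auto simp: card_image inj_on_def)

text \<open>Double counting of the pairs formed by a set \<open>C\<close> and a list entry above
  it.\<close>

lemma sum_sum_list_of_bool:
  assumes "finite S"
  shows "(\<Sum>C\<in>S. \<Sum>A\<leftarrow>B. of_bool (C \<subseteq> A)) = (\<Sum>A\<leftarrow>B. card {C\<in>S. C \<subseteq> A})"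
proof (induction B)
  case (Cons A B)
  have "(\<Sum>C\<in>S. of_bool (C \<subseteq> A)) = card {C\<in>S. C \<subseteq> A}"
    using assms by (simp add: of_bool_def sum.If_cases Int_def)
  then show ?case using Cons by (simp add: sum.distrib)
qed simp

lemma prob_bind_bernoulli_pmf:
  assumes "0 \<le> p" "p \<le> 1"
  shows "measure_pmf.prob (bernoulli_pmf p \<bind> f) X =
    p * measure_pmf.prob (f True) X + (1 - p) * measure_pmf.prob (f False) X"
proof -
  have "ennreal (measure_pmf.prob (bernoulli_pmf p \<bind> f) X) =
      ennreal (p * measure_pmf.prob (f True) X + (1 - p) * measure_pmf.prob (f False) X)"
    using assms
    by (simp flip: measure_pmf.emeasure_eq_measure)
       (simp add: measure_pmf.emeasure_eq_measure mult.commute ennreal_plus ennreal_mult')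
  then show ?thesis
    by (subst (asm) ennreal_inj) (use assms in \<open>auto intro!: add_nonneg_nonneg mult_nonneg_nonneg\<close>)
qed

text \<open>\<open>l\<close> is the largest label in use. The invariant \<open>labels\<close> says
  that labels have no gaps, so the \<open>LEAST\<close> in \<open>new_vertex\<close> yields the next
  one and the vertex count is determined by \<open>l\<close>.\<close>

locale history =
  fixes N :: nat and h :: "vertex set list" and g :: state and l :: nat
  assumes N3: "N \<ge> 3"
    and g: "g = history_state N h"
    and sizes: "\<And>A. A \<in> set h \<Longrightarrow> finite A \<and> card A = N"
    and labels: "verts g = Anon ` {..<N - 1} \<union> Lab ` {..l}"
begin

lemma finite_verts: "finite (verts g)"
  by (simp add: labels)

lemma card_verts: "card (verts g) = N + l"
proof -
  have "card (verts g) = card (Anon ` {..<N - 1}) + card (Lab ` {..l})"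
    unfolding labels by (rule card_Un_disjoint) auto
  then show ?thesis using N3 by (simp add: card_image inj_on_def)
qed

lemma new_vertex_eq: "new_vertex g = Lab (Suc l)"
proof -
  have "(LEAST k. Lab k \<notin> verts g) = Suc l"
    by (rule Least_equality) (auto simp: labels)
  then show ?thesis by (simp add: new_vertex_def)
qed

lemma new_vertex_notin: "new_vertex g \<notin> verts g"
  by (auto simp: new_vertex_eq labels)

section \<open>Cliques and their total weights\<close>

lemma finite_cliques: "finite (cliques m g)"
  by (rule finite_subset[of _ "Pow (verts g)"]) (auto simp: cliques_def finite_verts)

lemma all_sizes: "A \<in> set (initial_verts N # h) \<Longrightarrow> finite A \<and> card A = N"
  using sizes card_initial_verts finite_initial_verts N3 by auto

text \<open>All edges inside an interacting set have been drawn, so its subsets are cliques.\<close>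

lemma cliques_below:
  assumes "A \<in> set (initial_verts N # h)" "m \<ge> 1"
  shows "{C\<in>cliques m g. C \<subseteq> A} = {C. C \<subseteq> A \<and> card C = m}"
proof -
  have "C \<in> cliques m g" if "C \<subseteq> A" "card C = m" for C
  proof -
    have "C \<subseteq> verts g" using that assms unfolding g verts_history_state by blast
    moreover have "finite C" using that assms(2) card.infinite by fastforce
    moreover have "e \<in> edges g" if "e \<subseteq> C" "card e = 2" for e
      unfolding g edges_history_state using that \<open>C \<subseteq> A\<close> assms(1) by blast
    ultimately show ?thesis using that by (simp add: cliques_def)
  qed
  then show ?thesis by (auto simp: cliques_def)
qed

text \<open>Each interacting set, and the initial one, contributes as many units as it has subsets
  of size \<open>m\<close>. Cliques assembled from edges of several interactions without lying in
  one of them have weight 0.\<close>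

lemma sum_weight_cliques:
  assumes "m \<ge> 1"
  shows "(\<Sum>C\<in>cliques m g. weight g C) = Suc (length h) * (N choose m)"
proof -
  have "(\<Sum>C\<in>cliques m g. weight g C) =
      (\<Sum>C\<in>cliques m g. \<Sum>A\<leftarrow>initial_verts N # h. of_bool (C \<subseteq> A))"
    using assms unfolding g by (intro sum.cong refl weight_history_state) (auto simp: cliques_def)
  also have "\<dots> = (\<Sum>A\<leftarrow>initial_verts N # h. card {C\<in>cliques m g. C \<subseteq> A})"
    by (rule sum_sum_list_of_bool) (rule finite_cliques)
  also have "\<dots> = (\<Sum>A\<leftarrow>initial_verts N # h. N choose m)"
  proof (intro arg_cong[where f = sum_list] map_cong refl)
    fix A assume A: "A \<in> set (initial_verts N # h)"
    show "card {C\<in>cliques m g. C \<subseteq> A} = N choose m"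
      unfolding cliques_below[OF A assms] using n_subsets[of A m] all_sizes[OF A] by simp
  qed
  finally show ?thesis by (simp add: sum_list_triv)
qed

text \<open>The same double count for cliques through \<open>v\<close>: only sets containing
  \<open>v\<close> contribute, and their number is the weight of \<open>v\<close>.\<close>

lemma sum_weight_cliques_containing:
  assumes "m \<ge> 1"
  shows "(\<Sum>C\<in>{C\<in>cliques m g. v \<in> C}. weight g C) = weight g {v} * ((N - 1) choose (m - 1))"
proof -
  let ?S = "{C\<in>cliques m g. v \<in> C}"
  have "(\<Sum>C\<in>?S. weight g C) = (\<Sum>C\<in>?S. \<Sum>A\<leftarrow>initial_verts N # h. of_bool (C \<subseteq> A))"
    using assms unfolding g by (intro sum.cong refl weight_history_state) (auto simp: cliques_def)
  also have "\<dots> = (\<Sum>A\<leftarrow>initial_verts N # h. card {C\<in>?S. C \<subseteq> A})"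
    by (rule sum_sum_list_of_bool) (simp add: finite_cliques)
  also have "\<dots> = (\<Sum>A\<leftarrow>initial_verts N # h. of_bool ({v} \<subseteq> A) * ((N - 1) choose (m - 1)))"
  proof (intro arg_cong[where f = sum_list] map_cong refl)
    fix A assume A: "A \<in> set (initial_verts N # h)"
    have "{C\<in>?S. C \<subseteq> A} = {C. C \<subseteq> A \<and> card C = m \<and> v \<in> C}"
      using cliques_below[OF A assms] by blast
    then show "card {C\<in>?S. C \<subseteq> A} = of_bool ({v} \<subseteq> A) * ((N - 1) choose (m - 1))"
      using card_subsets_containing[of A N m v] all_sizes[OF A] assms by simp
  qed
  also have "\<dots> = weight g {v} * ((N - 1) choose (m - 1))"
    unfolding g by (subst weight_history_state) (simp_all add: sum_list_mult_const distrib_right)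
  finally show ?thesis .
qed

lemma weight_pos_iff: "weight g {v} > 0 \<longleftrightarrow> v \<in> verts g"
  unfolding g verts_history_state by (subst weight_history_state) (auto simp: sum_list_eq_0_iff simp flip: neq0_conv)

text \<open>This is the condition under which \<open>proportional_pmf\<close> has its intended
  meaning.\<close>

lemma sum_weight_cliques_pos:
  assumes "1 \<le> m" "m \<le> N"
  shows "(\<Sum>C\<in>cliques m g. real (weight g C)) > 0"
proof -
  have "0 < Suc (length h) * (N choose m)" using assms by (simp add: zero_less_binomial del: mult_Suc)
  then show ?thesis
    unfolding sum_weight_cliques[OF assms(1), symmetric] by (simp only: of_nat_0_less_iff flip: of_nat_sum)
qed

lemma set_proportional_pmf:
  assumes "1 \<le> m" "m \<le> N"
  shows "set_pmf (proportional_pmf (weight g) (cliques m g)) \<subseteq> {A. A \<subseteq> verts g \<and> card A = m}"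
  using pmf_proportional_pmf[OF finite_cliques sum_weight_cliques_pos[OF assms]]
  by (auto simp: set_pmf_eq cliques_def split: if_splits)

text \<open>Quotient of the two weight totals. Since all interacting sets have size
  \<open>N\<close>, the binomials reduce to m / N and the answer is linear in the weight of the
  vertex.\<close>

lemma prob_proportional_pmf:
  assumes "1 \<le> m" "m \<le> N"
  shows "measure_pmf.prob (proportional_pmf (weight g) (cliques m g)) {A. v \<in> A} =
     real m / real N * (real (weight g {v}) / (length h + 1))"
proof -
  let ?X = "proportional_pmf (weight g) (cliques m g)"
  note pmf = pmf_proportional_pmf[OF finite_cliques sum_weight_cliques_pos[OF assms]]
  have "measure_pmf.prob ?X {A. v \<in> A} = measure_pmf.prob ?X {A\<in>cliques m g. v \<in> A}"
    by (intro measure_pmf.finite_measure_eq_AE AE_pmfI) (auto simp: set_pmf_eq pmf split: if_splits)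
  also have "\<dots> = (\<Sum>A\<in>{A\<in>cliques m g. v \<in> A}. pmf ?X A)"
    by (rule measure_measure_pmf_finite) (simp add: finite_cliques)
  also have "\<dots> = (\<Sum>A\<in>{A\<in>cliques m g. v \<in> A}. real (weight g A)) / (\<Sum>C\<in>cliques m g. real (weight g C))"
    unfolding sum_divide_distrib by (intro sum.cong refl) (auto simp: pmf)
  also have "\<dots> = real (weight g {v}) / (length h + 1) * (real ((N - 1) choose (m - 1)) / real (N choose m))"
    using assms by (simp flip: of_nat_sum add: sum_weight_cliques sum_weight_cliques_containing distrib_right)
  finally show ?thesis unfolding choose_quotient[OF assms] by (simp only: mult.commute)
qed

lemma uniform_support:
  assumes "m \<le> N"
  shows "finite {A. A \<subseteq> verts g \<and> card A = m}" "{A. A \<subseteq> verts g \<and> card A = m} \<noteq> {}"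
proof -
  show fin: "finite {A. A \<subseteq> verts g \<and> card A = m}" using finite_verts by simp
  have "card {A. A \<subseteq> verts g \<and> card A = m} > 0"
    using assms by (simp add: n_subsets finite_verts card_verts)
  then show "{A. A \<subseteq> verts g \<and> card A = m} \<noteq> {}" by fastforce
qed

lemma set_uniform_subset_pmf:
  assumes "m \<le> N"
  shows "set_pmf (uniform_subset_pmf m (verts g)) = {A. A \<subseteq> verts g \<and> card A = m}"
  using uniform_support[OF assms] by (simp add: uniform_subset_pmf_def)

lemma prob_uniform_subset_pmf:
  assumes "1 \<le> m" "m \<le> N" "v \<in> verts g"
  shows "measure_pmf.prob (uniform_subset_pmf m (verts g)) {A. v \<in> A} = real m / card (verts g)"
proof -
  have "{A. A \<subseteq> verts g \<and> card A = m} \<inter> {A. v \<in> A} = {A. A \<subseteq> verts g \<and> card A = m \<and> v \<in> A}"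
    by auto
  then show ?thesis
    using assms uniform_support[OF assms(2)] card_subsets_containing[OF finite_verts refl assms(1)]
      choose_quotient[of m "card (verts g)"]
    by (simp add: uniform_subset_pmf_def measure_pmf_of_set n_subsets finite_verts card_verts)
qed

section \<open>The next interacting set: support and participation probabilities\<close>

lemma card_insert_new_vertex:
  assumes "B \<subseteq> verts g" "card B = N - 1"
  shows "finite (insert (new_vertex g) B) \<and> card (insert (new_vertex g) B) = N"
proof -
  have "finite B" "new_vertex g \<notin> B"
    using assms(1) finite_verts finite_subset new_vertex_notin by blast+
  then show ?thesis using assms(2) N3 by simp
qed

text \<open>In either branch at most one vertex is new and it carries the next label; this is what
  preserves the invariant in \<open>history_snoc\<close>.\<close>

lemma set_interacting_pmf:
  assumes "A \<in> set_pmf (interacting_pmf N p q r g)"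
  shows "finite A" "card A = N"
    "A \<subseteq> verts g \<or> verts g \<union> A = insert (new_vertex g) (verts g)"
proof -
  have "(\<exists>B. A = insert (new_vertex g) B \<and> B \<subseteq> verts g \<and> card B = N - 1) \<or> (A \<subseteq> verts g \<and> card A = N)"
  proof -
    let ?X = "\<lambda>m by_weight. if by_weight then proportional_pmf (weight g) (cliques m g)
                else uniform_subset_pmf m (verts g)"
    have X: "B \<subseteq> verts g \<and> card B = m" if "B \<in> set_pmf (?X m b)" "1 \<le> m" "m \<le> N" for B m b
      using that set_proportional_pmf[of m] set_uniform_subset_pmf[of m] by (cases b) auto
    obtain b where b: "A \<in> set_pmf (if b
        then bernoulli_pmf r \<bind> (\<lambda>b. ?X (N - 1) b \<bind> (\<lambda>A. return_pmf (insert (new_vertex g) A)))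
        else bernoulli_pmf q \<bind> ?X N)"
      using assms unfolding interacting_pmf_def set_bind_pmf by blast
    show ?thesis
    proof (cases b)
      case True
      then obtain b' B where B: "B \<in> set_pmf (?X (N - 1) b')" "A = insert (new_vertex g) B"
        using b by (simp only: if_True set_bind_pmf set_return_pmf) blast
      have "B \<subseteq> verts g \<and> card B = N - 1" by (rule X[OF B(1)]) (use N3 in simp_all)
      then show ?thesis using B(2) by blast
    next
      case False
      then obtain b' where A: "A \<in> set_pmf (?X N b')"
        using b by (simp only: if_False set_bind_pmf) blast
      have "A \<subseteq> verts g \<and> card A = N" by (rule X[OF A]) (use N3 in simp_all)
      then show ?thesis by blast
    qed
  qed
  then have "finite A \<and> card A = N \<and>
    (A \<subseteq> verts g \<or> verts g \<union> A = insert (new_vertex g) (verts g))"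
  proof (elim disjE exE conjE)
    fix B assume B: "A = insert (new_vertex g) B" "B \<subseteq> verts g" "card B = N - 1"
    have "verts g \<union> A = insert (new_vertex g) (verts g)" using B(1,2) by auto
    then show ?thesis using card_insert_new_vertex[OF B(2,3)] B(1) by simp
  qed (use finite_subset[of A, OF _ finite_verts] in blast)
  then show "finite A" "card A = N"
    "A \<subseteq> verts g \<or> verts g \<union> A = insert (new_vertex g) (verts g)"
    by blast+
qed

lemma history_snoc:
  assumes "A \<in> set_pmf (interacting_pmf N p q r g)"
  shows "\<exists>l. history N (h @ [A]) (interact A g) l"
proof -
  note A = set_interacting_pmf[OF assms]
  have "\<exists>l'. verts (interact A g) = Anon ` {..<N - 1} \<union> Lab ` {..l'}"
    using A(3)
  proof
    assume "A \<subseteq> verts g"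
    then have "verts (interact A g) = verts g" by (auto simp: interact_def)
    then show ?thesis using labels by auto
  next
    assume "verts g \<union> A = insert (new_vertex g) (verts g)"
    then have "verts (interact A g) = Anon ` {..<N - 1} \<union> Lab ` {..Suc l}"
      by (simp add: interact_def new_vertex_eq labels atMost_Suc)
    then show ?thesis by blast
  qed
  then show ?thesis
    unfolding history_def using N3 g sizes A(1,2) by (auto simp: history_state_snoc)
qed

context
  fixes p q r :: real
  assumes p: "0 \<le> p" "p \<le> 1" and q: "0 \<le> q" "q \<le> 1" and r: "0 \<le> r" "r \<le> 1"
begin

text \<open>Given the branch the event is deterministic: certain when a vertex is inserted,
  impossible when only old vertices interact.\<close>

lemma prob_new_vertex:
  "measure_pmf.prob (interacting_pmf N p q r g) {A. \<not> A \<subseteq> verts g} = p"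
proof -
  let ?X = "\<lambda>m by_weight. if by_weight then proportional_pmf (weight g) (cliques m g)
              else uniform_subset_pmf m (verts g)"
  let ?E = "{A. \<not> A \<subseteq> verts g}"
  have old: "measure_pmf.prob (bernoulli_pmf q \<bind> ?X N) ?E = 0"
  proof -
    have "A \<subseteq> verts g" if "A \<in> set_pmf (?X N b)" for A b
      using that set_proportional_pmf[of N] set_uniform_subset_pmf[of N] N3
      by (cases b) auto
    then show ?thesis
      unfolding measure_pmf_zero_iff by fastforce
  qed
  have new: "measure_pmf.prob (bernoulli_pmf r \<bind> (\<lambda>b. ?X (N - 1) b \<bind> 
      (\<lambda>A. return_pmf (insert (new_vertex g) A)))) ?E = 1"
    by (rule measure_pmf.prob_eq_1[THEN iffD2]) (auto simp: AE_measure_pmf_iff new_vertex_notin)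
  show ?thesis
    unfolding interacting_pmf_def prob_bind_bernoulli_pmf[OF p] if_True if_False old new by simp
qed

text \<open>A choice by weight has size \<open>N - 1\<close> with probability p r and size
  \<open>N\<close> with probability (1 - p) q. Weighting these by size over \<open>N\<close> gives
  the coefficient \<alpha>; the uniform choices give the second term.\<close>

lemma prob_interacting_pmf:
  assumes v: "v \<in> verts g"
  shows "measure_pmf.prob (interacting_pmf N p q r g) {A. v \<in> A} =
    interaction_alpha N p q r * (real (weight g {v}) / (length h + 1)) +
    (p * (1 - r) * real (N - 1) + (1 - p) * (1 - q) * real N) / card (verts g)"
proof -
  \<comment> \<open>The inserted vertex differs from the existing vertex \<open>v\<close>, so only
    the chosen old vertices count.\<close>
  have eq: "measure_pmf.prob (X \<bind> (\<lambda>A. return_pmf (insert (new_vertex g) A))) {A. v \<in> A} =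
     measure_pmf.prob X {A. v \<in> A}" for X
  proof -
    have "(\<lambda>A. insert (new_vertex g) A) -` {A. v \<in> A} = {A. v \<in> A}"
      using v new_vertex_notin by auto
    then show ?thesis
      by (simp flip: map_pmf_def)
  qed
  have arith: "p * (r * (real (N - 1) / real N * x) + (1 - r) * (real (N - 1) / V)) +
      (1 - p) * (q * (real N / real N * x) + (1 - q) * (real N / V)) =
    interaction_alpha N p q r * x + (p * (1 - r) * real (N - 1) + (1 - p) * (1 - q) * real N) / V" for x V
  proof -
    have alpha: "interaction_alpha N p q r = (1 - p) * q + real (N - 1) / real N * p * r"
      using N3 by (simp add: interaction_alpha_def)
    have "p * (r * (c * x) + (1 - r) * (a * u)) + (1 - p) * (q * (1 * x) + (1 - q) * (b * u)) =
      ((1 - p) * q + c * p * r) * x + (p * (1 - r) * a + (1 - p) * (1 - q) * b) * u" for a b c u :: real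
      by algebra
    moreover have "real N / real N = 1" using N3 by simp
    ultimately show ?thesis
      unfolding alpha divide_inverse[of _ V] by metis
  qed
  show ?thesis
    unfolding interacting_pmf_def prob_bind_bernoulli_pmf[OF p] prob_bind_bernoulli_pmf[OF q]
      prob_bind_bernoulli_pmf[OF r] if_True if_False eq
    arith[symmetric]
    using v N3 by (simp add: prob_proportional_pmf prob_uniform_subset_pmf)
qed

end

end

section \<open>The law of the history\<close>

text \<open>Adding \<open>B\<close> makes the integrand nonnegative, where the rule for
  \<open>nn_integral\<close> of a bind applies; linearity then removes \<open>B\<close>
  again.\<close>

lemma integral_bind_pmf_bounded:
  fixes f :: "'b \<Rightarrow> real"
  assumes bound: "\<And>x. \<bar>f x\<bar> \<le> B"
  shows "measure_pmf.expectation (X \<bind> Y) f =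
    measure_pmf.expectation X (\<lambda>x. measure_pmf.expectation (Y x) f)"
proof -
  let ?f = "\<lambda>x. f x + B"
  have f: "0 \<le> ?f x" "?f x \<le> 2 * B" for x using bound[of x] by auto
  have int: "integrable (measure_pmf Z) ?f" for Z
    by (rule measure_pmf.integrable_const_bound[where B = "2 * B"]) (use f in auto)
  have f_int: "integrable (measure_pmf Z) f" for Z
    by (rule measure_pmf.integrable_const_bound[where B = B]) (use bound in auto)
  have nonneg: "0 \<le> measure_pmf.expectation Z ?f" for Z
    using f by (intro Bochner_Integration.integral_nonneg) auto
  have le: "measure_pmf.expectation Z ?f \<le> 2 * B" for Z
    using f by (intro measure_pmf.integral_le_const int) auto
  have int': "integrable (measure_pmf X) (\<lambda>x. measure_pmf.expectation (Y x) ?f)"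
    by (rule measure_pmf.integrable_const_bound[where B = "2 * B"]) (use nonneg le in auto)
  have "ennreal (measure_pmf.expectation (X \<bind> Y) ?f) = (\<integral>\<^sup>+x. \<integral>\<^sup>+y. ?f y \<partial>Y x \<partial>X)"
    using f by (subst nn_integral_eq_integral[OF int, symmetric]) auto
  also have "\<dots> = (\<integral>\<^sup>+x. ennreal (measure_pmf.expectation (Y x) ?f) \<partial>X)"
    using f by (intro nn_integral_cong nn_integral_eq_integral int) auto
  also have "\<dots> = ennreal (measure_pmf.expectation X (\<lambda>x. measure_pmf.expectation (Y x) ?f))"
    using nonneg by (intro nn_integral_eq_integral int') auto
  finally have "measure_pmf.expectation (X \<bind> Y) ?f =
      measure_pmf.expectation X (\<lambda>x. measure_pmf.expectation (Y x) ?f)"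
    by (subst (asm) ennreal_inj) (auto intro!: Bochner_Integration.integral_nonneg nonneg f)
  moreover have "integrable (measure_pmf X) (\<lambda>x. measure_pmf.expectation (Y x) f)"
  proof (rule measure_pmf.integrable_const_bound[where B = B])
    have "\<bar>measure_pmf.expectation Z f\<bar> \<le> B" for Z
      using nonneg[of Z] le[of Z] by (simp add: f_int abs_le_iff)
    then show "AE x in measure_pmf X. norm (measure_pmf.expectation (Y x) f) \<le> B" by simp
  qed simp
  ultimately show ?thesis by (simp add: f_int)
qed

section \<open>The history as a random list, its distribution and its filtration\<close>

context N_interactions_model
begin

definition hist :: "nat \<Rightarrow> 'a \<Rightarrow> vertex set list" where
  "hist n \<omega> = map (\<lambda>k. I k \<omega>) [1..<Suc n]"

abbreviation st :: "vertex set list \<Rightarrow> state" where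
  "st h \<equiv> history_state N h"

abbreviation next_pmf :: "vertex set list \<Rightarrow> vertex set pmf" where
  "next_pmf h \<equiv> interacting_pmf N p q r (st h)"

text \<open>The intended law of the history, built from the one-step kernels. After
  \<open>distr_hist\<close> identifies it, expectations over \<open>M\<close> become integrals
  against pmfs.\<close>

primrec history_pmf :: "nat \<Rightarrow> vertex set list pmf" where
  "history_pmf 0 = return_pmf []"
| "history_pmf (Suc n) = history_pmf n \<bind> (\<lambda>h. map_pmf (\<lambda>A. h @ [A]) (next_pmf h))"

lemma hist_0: "hist 0 \<omega> = []"
  by (simp add: hist_def)

lemma hist_Suc: "hist (Suc n) \<omega> = hist n \<omega> @ [I (Suc n) \<omega>]"
  by (simp add: hist_def)

lemma length_hist: "length (hist n \<omega>) = n"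
  by (simp add: hist_def)

lemma set_history_pmf:
  assumes "h \<in> set_pmf (history_pmf n)"
  shows "length h = n" "\<exists>l. history N h (st h) l"
proof -
  have "length h = n \<and> (\<exists>l. history N h (st h) l)"
    using assms
  proof (induction n arbitrary: h)
    case 0
    have "history N [] (st []) 0"
      by unfold_locales (auto simp: N_ge_3 verts_history_state initial_verts_def)
    then show ?case using 0 by auto
  next
    case (Suc n)
    then obtain h' A where h: "h = h' @ [A]" "h' \<in> set_pmf (history_pmf n)" "A \<in> set_pmf (next_pmf h')"
      by auto
    then obtain l where "history N h' (st h') l" "length h' = n" using Suc.IH by blast
    then show ?case using history.history_snoc h by (auto simp: history_state_snoc)
  qed
  then show "length h = n" "\<exists>l. history N h (st h) l" by auto
qed

text \<open>A nonempty list determines its prefix and last entry, so only the prefix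
  \<open>h\<close> contributes to the mixture.\<close>

lemma pmf_history_Suc:
  "pmf (history_pmf (Suc n)) (h @ [A]) = pmf (history_pmf n) h * pmf (next_pmf h) A"
proof -
  have "pmf (map_pmf (\<lambda>A. h' @ [A]) (next_pmf h')) (h @ [A]) = pmf (next_pmf h) A * indicator {h} h'" for h'
  proof (cases "h' = h")
    case True
    then show ?thesis using pmf_map_inj'[of "\<lambda>A. h @ [A]" "next_pmf h" A] by (simp add: inj_def)
  next
    case False
    then have "h @ [A] \<notin> set_pmf (map_pmf (\<lambda>A. h' @ [A]) (next_pmf h'))" by auto
    then show ?thesis using False by (simp add: pmf_eq_0_set_pmf)
  qed
  then show ?thesis by (simp add: pmf_bind measure_pmf_single)
qed

lemma I_vimage: "n \<ge> 1 \<Longrightarrow> {\<omega>\<in>space M. I n \<omega> = A} \<in> sets M"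
proof (cases "finite A")
  case True
  assume "n \<ge> 1"
  then have "I n -` {A} \<inter> space M \<in> sets M"
    using True by (intro measurable_sets[OF I_measurable]) auto
  then show ?thesis by (simp add: vimage_def Int_def conj_commute)
next
  case False
  assume "n \<ge> 1"
  then have eq: "{\<omega>\<in>space M. I n \<omega> = A} = {}"
    using measurable_space[OF I_measurable] False by fastforce
  show ?thesis unfolding eq by simp
qed

lemma hist_vimage: "{\<omega>\<in>space M. hist n \<omega> = h} \<in> sets M"
proof (induction n arbitrary: h)
  case 0
  then show ?case by (simp add: hist_0)
next
  case (Suc n)
  show ?case
  proof (cases h rule: rev_cases)
    case (snoc h' A)
    then have "{\<omega>\<in>space M. hist (Suc n) \<omega> = h} =
        {\<omega>\<in>space M. hist n \<omega> = h'} \<inter> {\<omega>\<in>space M. I (Suc n) \<omega> = A}"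
      by (auto simp: hist_Suc)
    then show ?thesis using Suc I_vimage[of "Suc n"] by simp
  qed (simp add: hist_Suc)
qed

text \<open>Chain rule by induction: \<open>I_step\<close> supplies the new factor if the past has
  positive probability; otherwise both sides vanish.\<close>

lemma prob_hist: "prob {\<omega>\<in>space M. hist n \<omega> = h} = pmf (history_pmf n) h"
proof (induction n arbitrary: h)
  case 0
  then show ?case by (auto simp: hist_0 prob_space indicator_def)
next
  case (Suc n)
  show ?case
  proof (cases h rule: rev_cases)
    case Nil
    then have "h \<notin> set_pmf (history_pmf (Suc n))" using set_history_pmf(1) by fastforce
    then show ?thesis using Nil by (simp add: hist_Suc pmf_eq_0_set_pmf del: history_pmf.simps)
  next
    case (snoc h' A)
    \<comment> \<open>Steps are numbered from 1, list positions from 0.\<close>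
    define a where "a k = h ! (k - 1)" for k
    let ?P = "{\<omega>\<in>space M. hist n \<omega> = h'}"
    have eq: "{\<omega>\<in>space M. hist (Suc n) \<omega> = h} = {\<omega>\<in>space M. I (Suc n) \<omega> = A \<and> hist n \<omega> = h'}"
      using snoc by (auto simp: hist_Suc)
    show ?thesis
    proof (cases "prob ?P = 0")
      case True
      have "prob {\<omega>\<in>space M. hist (Suc n) \<omega> = h} \<le> prob ?P"
        by (rule finite_measure_mono) (auto simp: eq hist_vimage)
      then show ?thesis
        using True Suc[of h'] unfolding snoc pmf_history_Suc
        by (simp add: measure_le_0_iff)
    next
      case False
      \<comment> \<open>An outcome realising the prefix exists, which fixes the length of the
        prefix.\<close>
      then obtain \<omega> where "hist n \<omega> = h'" by fastforce
      then have len: "length h' = n" using length_hist by blast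
      have h'_eq: "h' = map a [1..<Suc n]"
        using len snoc by (intro nth_equalityI) (auto simp: a_def nth_append simp del: upt_Suc)
      have a_n: "a (Suc n) = A" by (simp add: a_def snoc nth_append len)
      have iff: "(\<forall>k\<in>{1..n}. I k \<omega> = a k) \<longleftrightarrow> hist n \<omega> = h'" for \<omega>
        unfolding hist_def h'_eq map_eq_conv by (auto simp del: upt_Suc)
      have pos: "prob {\<omega>\<in>space M. \<forall>k\<in>{1..n}. I k \<omega> = a k} > 0"
        unfolding iff using False by (simp add: zero_less_measure_iff)
      have "\<P>(\<omega> in M. I (Suc n) \<omega> = A \<bar> hist n \<omega> = h') = pmf (next_pmf h') A"
        using I_step[OF pos] unfolding iff a_n state_after_eq_history_state h'_eq[symmetric] .
      then show ?thesis
        using False Suc[of h'] unfolding eq cond_prob_def unfolding snoc pmf_history_Suc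
        by (simp add: field_simps)
    qed
  qed
qed

lemma hist_finite: "\<omega> \<in> space M \<Longrightarrow> hist n \<omega> \<in> lists {A. finite A}"
  using measurable_space[OF I_measurable] by (fastforce simp: hist_def simp del: upt_Suc)

lemma countable_histories: "countable (lists {A :: vertex set. finite A})"
proof -
  have "(UNIV :: vertex set) = range Lab \<union> range Anon"
    using vertex.exhaust by blast
  then have "countable (UNIV :: vertex set)" by (metis countable_Un countableI_type countable_image)
  from countable_Collect_finite_subset[OF this] show ?thesis by (intro countable_lists) simp
qed

text \<open>Histories take values in a countable set, so every preimage is a countable union of
  preimages of points.\<close>

lemma measurable_hist [measurable]: "hist n \<in> M \<rightarrow>\<^sub>M count_space UNIV"
proof (rule measurableI)
  fix X :: "vertex set list set"
  have "hist n -` X \<inter> space M = (\<Union>h\<in>X \<inter> lists {A. finite A}. {\<omega>\<in>space M. hist n \<omega> = h})"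
    using hist_finite by blast
  also have "\<dots> \<in> sets M"
    using countable_histories by (intro sets.countable_UN'' hist_vimage) auto
  finally show "hist n -` X \<inter> space M \<in> sets M" .
qed simp

lemma distr_hist: "distr M (count_space UNIV) (hist n) = measure_pmf (history_pmf n)"
proof (rule measure_eqI_countable_AE[OF _ _ _ _ countable_histories])
  show "AE h in distr M (count_space UNIV) (hist n). h \<in> lists {A. finite A}"
    using hist_finite by (subst AE_distr_iff) auto
  show "AE h in measure_pmf (history_pmf n). h \<in> lists {A. finite A}"
    using set_history_pmf(2) history.sizes by (fastforce simp: AE_measure_pmf_iff)
  fix h :: "vertex set list"
  have "hist n -` {h} \<inter> space M = {\<omega>\<in>space M. hist n \<omega> = h}" by auto
  then show "emeasure (distr M (count_space UNIV) (hist n)) {h} = emeasure (measure_pmf (history_pmf n)) {h}"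
    using prob_hist by (simp add: emeasure_distr emeasure_eq_measure emeasure_pmf_single)
qed simp_all

lemma measurable_hist_fun [measurable]: "(\<lambda>\<omega>. f (hist n \<omega>)) \<in> M \<rightarrow>\<^sub>M borel"
  by (rule measurable_compose[OF measurable_hist]) simp

lemma AE_hist: "AE \<omega> in M. \<exists>l. history N (hist n \<omega>) (st (hist n \<omega>)) l"
proof -
  have "AE h in distr M (count_space UNIV) (hist n). \<exists>l. history N h (st h) l"
    unfolding distr_hist using set_history_pmf(2) by (simp add: AE_measure_pmf_iff)
  then show ?thesis by (subst (asm) AE_distr_iff) auto
qed

lemma expectation_hist:
  fixes f :: "vertex set list \<Rightarrow> real"
  shows "expectation (\<lambda>\<omega>. f (hist n \<omega>)) = measure_pmf.expectation (history_pmf n) f"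
  unfolding distr_hist[symmetric] by (subst integral_distr) auto

text \<open>Averaging over the last interaction: the working form of the tower property.\<close>

lemma expectation_hist_Suc:
  fixes f :: "vertex set list \<Rightarrow> real"
  assumes "\<And>h. \<bar>f h\<bar> \<le> B"
  shows "expectation (\<lambda>\<omega>. f (hist (Suc n) \<omega>)) =
    expectation (\<lambda>\<omega>. measure_pmf.expectation (next_pmf (hist n \<omega>)) (\<lambda>A. f (hist n \<omega> @ [A])))"
  unfolding expectation_hist expectation_hist[of "\<lambda>h. measure_pmf.expectation (next_pmf h) (\<lambda>A. f (h @ [A]))"]
  by (simp add: integral_bind_pmf_bounded[OF assms])

lemma integrable_hist:
  fixes f :: "vertex set list \<Rightarrow> real"
  assumes "\<And>h. \<bar>f h\<bar> \<le> B"
  shows "integrable M (\<lambda>\<omega>. f (hist n \<omega>))"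
  by (rule integrable_const_bound[where B = B]) (use assms in auto)

lemma subalgebra_hist: "subalgebra M (vimage_algebra (space M) (hist n) (count_space UNIV))"
  unfolding subalgebra_def
  by (auto simp: sets_vimage_algebra2 intro!: measurable_sets[OF measurable_hist])

lemma hist_prefix: "m \<le> n \<Longrightarrow> hist m \<omega> = take m (hist n \<omega>)"
  by (simp add: hist_def take_map del: upt_Suc)

text \<open>An earlier history is a prefix, hence a function, of a later one.\<close>

lemma subalgebra_hist_mono:
  assumes "m \<le> n"
  shows "subalgebra (vimage_algebra (space M) (hist n) (count_space UNIV))
    (vimage_algebra (space M) (hist m) (count_space UNIV))"
proof -
  have "hist m -` A \<inter> space M = hist n -` (take m -` A) \<inter> space M" for A
    using hist_prefix[OF assms] by auto
  then show ?thesis unfolding subalgebra_def by (auto simp: sets_vimage_algebra2)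
qed

section \<open>Growth of the vertex set\<close>

lemma prob_next_new_vertex:
  assumes "history N h (st h) l"
  shows "measure_pmf.prob (next_pmf h) {A. \<not> A \<subseteq> verts (st h)} = p"
  using assms p_pos p_le_1 q_nonneg q_le_1 r_nonneg r_le_1
  by (intro history.prob_new_vertex) auto

text \<open>A new vertex halves this quantity and appears with conditional probability
  \<open>p\<close>, so each step multiplies the mean by \<open>1 - p / 2\<close>.\<close>

lemma expectation_half_power_verts:
  "expectation (\<lambda>\<omega>. (1 / 2) ^ card (verts (st (hist n \<omega>)))) \<le> (1 - p / 2) ^ n"
proof (induction n)
  case 0
  have "((1 / 2) ^ k :: real) \<le> 1" for k by (rule power_le_one) auto
  then show ?case by (simp add: hist_0 prob_space)
next
  case (Suc n)
  let ?f = "\<lambda>h. (1 / 2 :: real) ^ card (verts (st h))"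
  have f: "\<bar>?f h\<bar> \<le> 1" for h using power_le_one[of "1 / 2 :: real"] by simp
  have step: "measure_pmf.expectation (next_pmf h) (\<lambda>A. ?f (h @ [A])) = (1 - p / 2) * ?f h"
    if "history N h (st h) l" for h l
  proof -
    interpret history N h "st h" l by fact
    let ?E = "{A. \<not> A \<subseteq> verts (st h)}"
    have "measure_pmf.expectation (next_pmf h) (\<lambda>A. ?f (h @ [A])) =
        measure_pmf.expectation (next_pmf h) (\<lambda>A. ?f h * (1 - indicator ?E A / 2))"
    proof (intro integral_cong_AE AE_pmfI)
      fix A assume "A \<in> set_pmf (next_pmf h)"
      note A = set_interacting_pmf(3)[OF this]
      show "?f (h @ [A]) = ?f h * (1 - indicator ?E A / 2)"
      proof (cases "A \<subseteq> verts (st h)")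
        case True
        then show ?thesis by (simp add: history_state_snoc interact_def Un_absorb2)
      next
        case False
        then show ?thesis
          using A new_vertex_notin finite_verts by (simp add: history_state_snoc interact_def)
      qed
    qed simp_all
    also have "\<dots> = ?f h * (1 - measure_pmf.prob (next_pmf h) ?E / 2)"
      by (simp add: measure_pmf.emeasure_eq_measure)
    also have "measure_pmf.prob (next_pmf h) ?E = p" by (rule prob_next_new_vertex) fact
    finally show ?thesis by (simp add: mult.commute)
  qed
  have "AE \<omega> in M. measure_pmf.expectation (next_pmf (hist n \<omega>)) (\<lambda>A. ?f (hist n \<omega> @ [A])) =
      (1 - p / 2) * ?f (hist n \<omega>)"
    using AE_hist[of n] by eventually_elim (elim exE, rule step)
  then have "expectation (\<lambda>\<omega>. measure_pmf.expectation (next_pmf (hist n \<omega>)) (\<lambda>A. ?f (hist n \<omega> @ [A]))) =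
      expectation (\<lambda>\<omega>. (1 - p / 2) * ?f (hist n \<omega>))"
    by (intro integral_cong_AE measurable_hist_fun[of "\<lambda>h. measure_pmf.expectation (next_pmf h) (\<lambda>A. ?f (h @ [A]))"]) auto
  also have "\<dots> \<le> (1 - p / 2) * (1 - p / 2) ^ n"
    using Suc p_le_1 by (simp add: mult_left_mono)
  finally show ?case
    using expectation_hist_Suc[of ?f, OF f, of n] by simp
qed

text \<open>An exponential moment bound replaces a law of large numbers: dividing by
  \<open>\<rho> ^ n\<close> leaves summable expectations, so almost surely the half power eventually
  drops below \<open>\<rho> ^ n\<close>.\<close>

lemma AE_card_verts_ge:
  "\<exists>c>0. AE \<omega> in M. eventually (\<lambda>n. real (card (verts (st (hist n \<omega>)))) \<ge> c * real n) sequentially"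
proof -
  \<comment> \<open>Any value strictly between \<open>1 - p / 2\<close> and 1 would do;
    \<open>c\<close> below solves (1/2) powr c = \<rho>.\<close>
  define \<rho> where "\<rho> = 1 - p / 4"
  have \<rho>: "0 < \<rho>" "\<rho> < 1" "1 - p / 2 < \<rho>" "0 \<le> 1 - p / 2" using p_pos p_le_1 by (auto simp: \<rho>_def)
  define c where "c = - ln \<rho> / ln 2"
  let ?v = "\<lambda>n \<omega>. card (verts (st (hist n \<omega>)))"
  let ?f = "\<lambda>n \<omega>. (1 / 2) ^ ?v n \<omega> / \<rho> ^ n"
  have le1: "((1 / 2) ^ k :: real) \<le> 1" for k by (rule power_le_one) auto
  have "AE \<omega> in M. summable (\<lambda>n. ?f n \<omega>)"
  proof (rule AE_summable_of_summable_expectation)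
    show "integrable M (?f n)" for n
      by (intro integrable_divide integrable_hist[where B = 1 and f = "\<lambda>h. (1 / 2) ^ card (verts (st h))"])
         (simp add: le1)
    show "0 \<le> ?f n \<omega>" for n \<omega> using \<rho> by simp
    show "summable (\<lambda>n. expectation (?f n))"
    proof (rule summable_comparison_test')
      show "summable (\<lambda>n. ((1 - p / 2) / \<rho>) ^ n)" using \<rho> by (intro summable_geometric) simp
      show "norm (expectation (?f n)) \<le> ((1 - p / 2) / \<rho>) ^ n" if "0 \<le> n" for n
      proof -
        have eq: "expectation (?f n) = expectation (\<lambda>\<omega>. (1 / 2) ^ ?v n \<omega>) / \<rho> ^ n"
          by (rule Bochner_Integration.integral_divide_zero)
        have "0 \<le> expectation (?f n)" using \<rho> by (intro Bochner_Integration.integral_nonneg) simp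
        moreover have "expectation (?f n) \<le> ((1 - p / 2) / \<rho>) ^ n"
          unfolding eq power_divide[of "1 - p / 2"] using \<rho> expectation_half_power_verts by (intro divide_right_mono) auto
        ultimately show ?thesis unfolding real_norm_def by linarith
      qed
    qed
  qed
  then have "AE \<omega> in M. eventually (\<lambda>n. real (?v n \<omega>) \<ge> c * real n) sequentially"
  proof eventually_elim
    case (elim \<omega>)
    have "eventually (\<lambda>n. ?f n \<omega> < 1) sequentially"
      using order_tendstoD(2)[OF summable_LIMSEQ_zero[OF elim], of 1] by simp
    then show ?case
    proof eventually_elim
      case (elim n)
      then have "(1 / 2) ^ ?v n \<omega> \<le> \<rho> ^ n" using \<rho> by simp
      then have "ln ((1 / 2) ^ ?v n \<omega>) \<le> ln (\<rho> ^ n)" using \<rho> by (subst ln_le_cancel_iff) auto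
      then have "- (ln 2 * real (?v n \<omega>)) \<le> real n * ln \<rho>"
        using \<rho> by (simp add: ln_realpow ln_div mult.commute)
      then show ?case by (simp add: c_def field_simps)
    qed
  qed
  moreover have "c > 0" unfolding c_def using \<rho> by (simp add: divide_neg_pos)
  ultimately show ?thesis by blast
qed

end

section \<open>The weight of a fixed vertex\<close>

text \<open>The case \<open>w = 0\<close> is included through \<open>1 / 0 = 0\<close>; it covers
  the time before the vertex exists.\<close>

lemma ln_le_inverse: "ln (1 + 1 / real w) \<le> 1 / real w" "0 \<le> ln (1 + 1 / real w)"
  by (auto intro: ln_add_one_self_le_self)

lemma inverse_le_1: "1 / real w \<le> 1" "1 / (real w)\<^sup>2 \<le> 1"
  by (cases "w = 0"; simp)+

lemma log_factor_bounded: "\<bar>ln (1 + 1 / real w) * (of_bool b - measure_pmf.prob X E)\<bar> \<le> 1"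
proof -
  have "\<bar>ln (1 + 1 / real w)\<bar> \<le> 1" using ln_le_inverse[of w] inverse_le_1(1)[of w] by linarith
  moreover have "\<bar>of_bool b - measure_pmf.prob X E\<bar> \<le> 1"
    by (cases b) (auto simp: abs_le_iff)
  ultimately show ?thesis unfolding abs_mult by (metis abs_ge_zero mult_le_one)
qed

lemma integrable_of_bool: "integrable (measure_pmf X) (\<lambda>A. of_bool (P A) :: real)"
  by (rule measure_pmf.integrable_const_bound[where B = 1]) auto

section \<open>Martingale part and conditional variances of the logarithmic weight\<close>

context N_interactions_model
begin

context
  fixes j :: nat
begin

abbreviation W :: "vertex set list \<Rightarrow> nat" where
  "W h \<equiv> weight (st h) {Lab j}"

abbreviation participation :: "vertex set list \<Rightarrow> real" where
  "participation h \<equiv> measure_pmf.prob (next_pmf h) {A. Lab j \<in> A}"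

lemma W_snoc: "W (h @ [A]) = W h + of_bool (Lab j \<in> A)"
  by (simp add: history_state_snoc interact_def)

text \<open>
  While the vertex does not exist, \<open>W h = 0\<close> and hence \<open>1 / W h = 0\<close>, so the factor \<open>ln (1 + 1 / W h)\<close>
  vanishes, and so does \<open>1 / (W h)\<^sup>2\<close>.
\<close>

definition log_increment :: "nat \<Rightarrow> 'a \<Rightarrow> real" where
  "log_increment n \<omega> = ln (1 + 1 / W (hist n \<omega>)) *
     (of_bool (Lab j \<in> I (Suc n) \<omega>) - participation (hist n \<omega>))"

text \<open>As a function of the next history the increment is visibly adapted, and
  \<open>expectation_hist_Suc\<close> applies to it.\<close>

lemma log_increment_eq:
  "log_increment n \<omega> = (\<lambda>h. ln (1 + 1 / W (butlast h)) *
     (of_bool (Lab j \<in> last h) - participation (butlast h))) (hist (Suc n) \<omega>)"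
  by (simp add: log_increment_def hist_Suc)

lemma expectation_participation:
  "measure_pmf.expectation (next_pmf h) (\<lambda>A. of_bool (Lab j \<in> A)) = participation h"
proof -
  have eq: "(\<lambda>A. of_bool (Lab j \<in> A) :: real) = indicator {A. Lab j \<in> A}"
    by (auto simp: fun_eq_iff indicator_def)
  show ?thesis unfolding eq by simp
qed

text \<open>Tested on an event of the past, which depends only on \<open>butlast\<close> of the next
  history; averaging over the last interaction annihilates the centred factor.\<close>

lemma log_increment_cond_exp:
  "AE \<omega> in M. real_cond_exp M (vimage_algebra (space M) (hist n) (count_space UNIV))
     (log_increment n) \<omega> = 0"
proof -
  let ?F = "vimage_algebra (space M) (hist n) (count_space UNIV)"
  interpret finite_measure_subalgebra M ?F by unfold_locales (rule subalgebra_hist)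
  let ?x = "\<lambda>h. ln (1 + 1 / W (butlast h)) *
     (of_bool (Lab j \<in> last h) - participation (butlast h))"
  show ?thesis
  proof (rule real_cond_exp_charact)
    fix A assume "A \<in> sets ?F"
    then obtain B where A: "A = hist n -` B \<inter> space M" by (auto simp: sets_vimage_algebra2)
    have "(\<integral>\<omega>\<in>A. log_increment n \<omega> \<partial>M) = expectation (\<lambda>\<omega>. indicator B (butlast (hist (Suc n) \<omega>)) * ?x (hist (Suc n) \<omega>))"
      unfolding set_lebesgue_integral_def log_increment_eq A
      by (intro Bochner_Integration.integral_cong refl) (simp add: hist_Suc indicator_def)
    also have "\<dots> = expectation (\<lambda>\<omega>. measure_pmf.expectation (next_pmf (hist n \<omega>))
        (\<lambda>A. indicator B (butlast (hist n \<omega> @ [A])) * ?x (hist n \<omega> @ [A])))"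
    proof (rule expectation_hist_Suc[where B = 1])
      fix h :: "vertex set list"
      show "\<bar>indicator B (butlast h) * ?x h\<bar> \<le> 1"
        by (cases "butlast h \<in> B")
           (simp_all only: indicator_simps not_False_eq_True mult_1_left mult_zero_left abs_zero zero_le_one log_factor_bounded)
    qed
    also have "\<dots> = 0"
      by (simp add: integrable_of_bool expectation_participation)
    finally show "(\<integral>\<omega>\<in>A. log_increment n \<omega> \<partial>M) = (\<integral>\<omega>\<in>A. 0 \<partial>M)"
      by (simp add: set_lebesgue_integral_def)
  next
    show "integrable M (log_increment n)"
      unfolding log_increment_eq by (rule integrable_hist[where B = 1]) (rule log_factor_bounded)
  qed auto
qed

text \<open>Along any path, the sum telescopes: each value of the weight is left at most once.\<close>

lemma sum_participations:
  "(\<Sum>k<n. of_bool (Lab j \<in> I (Suc k) \<omega>) / (real (W (hist k \<omega>)))\<^sup>2) \<le> (\<Sum>w. 1 / (real w)\<^sup>2)"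
proof -
  \<comment> \<open>Since \<open>1 / 0 = 0\<close>, the step at which the vertex enters adds 0 on
    both sides.\<close>
  have "(\<Sum>k<n. of_bool (Lab j \<in> I (Suc k) \<omega>) / (real (W (hist k \<omega>)))\<^sup>2) +
      (\<Sum>w<W (hist 0 \<omega>). 1 / (real w)\<^sup>2) = (\<Sum>w<W (hist n \<omega>). 1 / (real w)\<^sup>2)"
    by (induction n) (auto simp: hist_Suc W_snoc)
  moreover have "(\<Sum>w<W (hist 0 \<omega>). 1 / (real w)\<^sup>2) \<ge> 0" by (simp add: sum_nonneg)
  moreover have "(\<Sum>w<W (hist n \<omega>). 1 / (real w)\<^sup>2) \<le> (\<Sum>w. 1 / (real w)\<^sup>2)"
    using inverse_power_summable[of 2, where 'a = real]
    by (intro sum_le_suminf) (auto simp: inverse_eq_divide)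
  ultimately show ?thesis by linarith
qed

lemma expectation_participation_Suc:
  "expectation (\<lambda>\<omega>. of_bool (Lab j \<in> I (Suc n) \<omega>) / (real (W (hist n \<omega>)))\<^sup>2) =
   expectation (\<lambda>\<omega>. participation (hist n \<omega>) / (real (W (hist n \<omega>)))\<^sup>2)"
proof -
  let ?f = "\<lambda>h. of_bool (Lab j \<in> last h) / (real (W (butlast h)))\<^sup>2"
  have "\<bar>?f h\<bar> \<le> 1" for h
    using inverse_le_1(2) by simp
  from expectation_hist_Suc[of ?f, OF this, of n] show ?thesis
    by (simp add: hist_Suc expectation_participation)
qed

lemma integrable_participation_Suc:
  "integrable M (\<lambda>\<omega>. of_bool (Lab j \<in> I (Suc n) \<omega>) / (real (W (hist n \<omega>)))\<^sup>2)"
proof -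
  let ?f = "\<lambda>h. of_bool (Lab j \<in> last h) / (real (W (butlast h)))\<^sup>2"
  have "\<bar>?f h\<bar> \<le> 1" for h
    using inverse_le_1(2) by simp
  from integrable_hist[of ?f, OF this, of "Suc n"] show ?thesis
    by (simp add: hist_Suc)
qed

text \<open>The bound of \<open>sum_participations\<close> is the same constant on every path, so it
  passes to the expectations of the partial sums.\<close>

lemma summable_expectation_participation:
  "summable (\<lambda>n. expectation (\<lambda>\<omega>. participation (hist n \<omega>) / (real (W (hist n \<omega>)))\<^sup>2))"
  unfolding expectation_participation_Suc[symmetric]
proof (rule summableI_nonneg_bounded)
  show "0 \<le> expectation (\<lambda>\<omega>. of_bool (Lab j \<in> I (Suc n) \<omega>) / (real (W (hist n \<omega>)))\<^sup>2)" for n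
    by (intro Bochner_Integration.integral_nonneg) simp
  show "(\<Sum>k<n. expectation (\<lambda>\<omega>. of_bool (Lab j \<in> I (Suc k) \<omega>) / (real (W (hist k \<omega>)))\<^sup>2))
      \<le> (\<Sum>w. 1 / (real w)\<^sup>2)" for n
    unfolding Bochner_Integration.integral_sum[OF integrable_participation_Suc, symmetric]
    by (intro integral_le_const Bochner_Integration.integrable_sum integrable_participation_Suc AE_I2 sum_participations)
qed

lemma AE_summable_participation:
  "AE \<omega> in M. summable (\<lambda>n. participation (hist n \<omega>) / (real (W (hist n \<omega>)))\<^sup>2)"
proof (rule AE_summable_of_summable_expectation[OF _ _ summable_expectation_participation])
  show "integrable M (\<lambda>\<omega>. participation (hist n \<omega>) / (real (W (hist n \<omega>)))\<^sup>2)" for n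
  proof (rule integrable_hist[where B = 1 and f = "\<lambda>h. participation h / (real (W h))\<^sup>2"])
    fix h
    have "participation h * (1 / (real (W h))\<^sup>2) \<le> 1 * 1"
      by (intro mult_mono inverse_le_1) auto
    then show "\<bar>participation h / (real (W h))\<^sup>2\<bar> \<le> 1" by simp
  qed
qed simp

text \<open>The indicator has conditional variance \<pi> (1 - \<pi>) \<le> \<pi>, and the
  logarithmic factor is at most 1 / W.\<close>

lemma expectation_log_increment_sq:
  "expectation (\<lambda>\<omega>. (log_increment n \<omega>)\<^sup>2) \<le>
   expectation (\<lambda>\<omega>. participation (hist n \<omega>) / (real (W (hist n \<omega>)))\<^sup>2)"
proof -
  let ?c = "\<lambda>h. ln (1 + 1 / real (W h))"
  let ?x = "\<lambda>h. (?c (butlast h) * (of_bool (Lab j \<in> last h) - participation (butlast h)))\<^sup>2"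
  have x: "\<bar>?x h\<bar> \<le> 1" for h
    unfolding abs_of_nonneg[OF zero_le_power2] abs_square_le_1 by (rule log_factor_bounded)
  have le: "(?c h)\<^sup>2 \<le> 1 / (real (W h))\<^sup>2" for h
    using power_mono[OF ln_le_inverse, of "W h" 2] by (simp add: power_one_over)
  have sq: "measure_pmf.expectation (next_pmf h) (\<lambda>A. ?x (h @ [A])) \<le> participation h / (real (W h))\<^sup>2" for h
  proof -
    let ?\<pi> = "participation h"
    \<comment> \<open>The indicator equals its own square, so the centred square is affine in
      it.\<close>
    have "(?c h * (of_bool b - ?\<pi>))\<^sup>2 = (?c h)\<^sup>2 * ((1 - 2 * ?\<pi>) * of_bool b + ?\<pi>\<^sup>2)" for b
      by (cases b) (auto simp: power_mult_distrib power2_diff)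
    then have "measure_pmf.expectation (next_pmf h) (\<lambda>A. ?x (h @ [A])) =
        (?c h)\<^sup>2 * ((1 - 2 * ?\<pi>) * ?\<pi> + ?\<pi>\<^sup>2)"
      by (simp add: integrable_of_bool expectation_participation)
    also have "\<dots> \<le> (1 / (real (W h))\<^sup>2) * ?\<pi>"
    proof (rule mult_mono)
      show "(1 - 2 * ?\<pi>) * ?\<pi> + ?\<pi>\<^sup>2 \<le> ?\<pi>" by (simp add: power2_eq_square algebra_simps)
      have "(1 - 2 * ?\<pi>) * ?\<pi> + ?\<pi>\<^sup>2 = ?\<pi> * (1 - ?\<pi>)" by (simp add: power2_eq_square algebra_simps)
      also have "\<dots> \<ge> 0" by simp
      finally show "0 \<le> (1 - 2 * ?\<pi>) * ?\<pi> + ?\<pi>\<^sup>2" .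
    qed (use le in auto)
    finally show ?thesis by simp
  qed
  have "expectation (\<lambda>\<omega>. (log_increment n \<omega>)\<^sup>2) =
      expectation (\<lambda>\<omega>. measure_pmf.expectation (next_pmf (hist n \<omega>)) (\<lambda>A. ?x (hist n \<omega> @ [A])))"
    unfolding log_increment_eq by (rule expectation_hist_Suc[OF x])
  also have "\<dots> \<le> expectation (\<lambda>\<omega>. participation (hist n \<omega>) / (real (W (hist n \<omega>)))\<^sup>2)"
  proof (rule integral_mono)
    have b: "\<bar>participation h / (real (W h))\<^sup>2\<bar> \<le> 1" for h
      using mult_mono[OF measure_pmf.prob_le_1[of "next_pmf h" "{A. Lab j \<in> A}"] inverse_le_1(2)[of "W h"]] by simp
    then show "integrable M (\<lambda>\<omega>. participation (hist n \<omega>) / (real (W (hist n \<omega>)))\<^sup>2)"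
      by (rule integrable_hist)
    show "integrable M (\<lambda>\<omega>. measure_pmf.expectation (next_pmf (hist n \<omega>)) (\<lambda>A. ?x (hist n \<omega> @ [A])))"
    proof (rule integrable_hist[where B = 1])
      fix h
      have "0 \<le> measure_pmf.expectation (next_pmf h) (\<lambda>A. ?x (h @ [A]))"
        by (intro Bochner_Integration.integral_nonneg) simp
      then show "\<bar>measure_pmf.expectation (next_pmf h) (\<lambda>A. ?x (h @ [A]))\<bar> \<le> 1"
        using sq[of h] b[of h] by linarith
    qed
  qed (rule sq)
  finally show ?thesis .
qed

lemma AE_summable_log_increment: "AE \<omega> in M. summable (\<lambda>n. log_increment n \<omega>)"
proof (rule martingale_differences_summable[where C = 1])
  show "log_increment n \<in> borel_measurable (vimage_algebra (space M) (hist (Suc n)) (count_space UNIV))" for n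
    unfolding log_increment_eq
    by (rule measurable_compose[OF measurable_vimage_algebra1]) auto
  show "\<bar>log_increment n \<omega>\<bar> \<le> 1" for n \<omega>
    unfolding log_increment_def by (rule log_factor_bounded)
  show "summable (\<lambda>n. expectation (\<lambda>\<omega>. (log_increment n \<omega>)\<^sup>2))"
    by (rule summable_comparison_test'[OF summable_expectation_participation])
       (simp add: expectation_log_increment_sq Bochner_Integration.integral_nonneg abs_of_nonneg)
qed (intro subalgebra_hist subalgebra_hist_mono log_increment_cond_exp; assumption)+

section \<open>From the history back to the vertex weight\<close>

lemma vertex_weight_eq: "vertex_weight N I n j \<omega> = W (hist n \<omega>)"
  by (simp add: vertex_weight_def state_after_eq_history_state hist_def del: upt_Suc state_after.simps)

lemma participation_eq:
  assumes "history N h (st h) l" "W h > 0"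
  shows "participation h = interaction_alpha N p q r * (real (W h) / (length h + 1)) +
    (p * (1 - r) * real (N - 1) + (1 - p) * (1 - q) * real N) / card (verts (st h))"
proof (rule history.prob_interacting_pmf[OF assms(1)])
  show "Lab j \<in> verts (st h)" using assms history.weight_pos_iff by blast
qed (use p_pos p_le_1 q_nonneg q_le_1 r_nonneg r_le_1 in auto)

text \<open>With \<open>N + l\<close> vertices the labels 0 to \<open>l\<close> are present, so the
  vertex count tells whether label \<open>j\<close> exists.\<close>

lemma weight_pos_of_card_verts:
  assumes "history N h (st h) l" "card (verts (st h)) \<ge> N + j"
  shows "W h > 0"
  using assms history.weight_pos_iff[OF assms(1)] history.card_verts[OF assms(1)] history.labels[OF assms(1)]
  by auto

theorem AE_vertex_weight_power_law:
  assumes "interaction_alpha N p q r > 0"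
  shows "AE \<omega> in M. \<exists>L>0. (\<lambda>n. real (vertex_weight N I n j \<omega>) / real n powr interaction_alpha N p q r) \<longlonglongrightarrow> L"
proof -
  obtain c where c: "c > 0"
    "AE \<omega> in M. eventually (\<lambda>n. real (card (verts (st (hist n \<omega>)))) \<ge> c * real n) sequentially"
    using AE_card_verts_ge by blast
  have "AE \<omega> in M. \<forall>n. \<exists>l. history N (hist n \<omega>) (st (hist n \<omega>)) l"
    using AE_hist by (simp add: AE_all_countable)
  then show ?thesis
    using c(2) AE_summable_participation AE_summable_log_increment
  proof eventually_elim
    case (elim \<omega>)
    have "filterlim (\<lambda>n. c * real n) at_top sequentially"
      using \<open>c > 0\<close> by (intro filterlim_tendsto_pos_mult_at_top[OF tendsto_const] filterlim_real_sequentially)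
    then have "eventually (\<lambda>n. c * real n \<ge> real (N + j)) sequentially"
      by (simp add: filterlim_at_top)
    with elim(2) have pos: "eventually (\<lambda>n. W (hist n \<omega>) > 0) sequentially"
    proof eventually_elim
      case (elim n)
      then have "card (verts (st (hist n \<omega>))) \<ge> N + j" by linarith
      then show ?case using \<open>\<forall>n. \<exists>l. history N (hist n \<omega>) (st (hist n \<omega>)) l\<close> weight_pos_of_card_verts by blast
    qed
    show ?case
      unfolding vertex_weight_eq
    \<comment> \<open>Here \<beta> is the mean number of uniformly chosen old vertices in a
      step.\<close>
    proof (rule counting_sequence_power_law[where c = c and \<pi> = "\<lambda>n. participation (hist n \<omega>)"
          and V = "\<lambda>n. card (verts (st (hist n \<omega>)))" and d = "\<lambda>n. Lab j \<in> I (Suc n) \<omega>"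
          and \<beta> = "p * (1 - r) * real (N - 1) + (1 - p) * (1 - q) * real N"])
      show "0 \<le> p * (1 - r) * real (N - 1) + (1 - p) * (1 - q) * real N"
        using p_pos p_le_1 q_le_1 r_le_1 by simp
      show "W (hist (Suc n) \<omega>) = W (hist n \<omega>) + of_bool (Lab j \<in> I (Suc n) \<omega>)" for n
        unfolding hist_Suc by (rule W_snoc)
      show "participation (hist n \<omega>) = interaction_alpha N p q r * (real (W (hist n \<omega>)) / (real n + 1)) +
          (p * (1 - r) * real (N - 1) + (1 - p) * (1 - q) * real N) / card (verts (st (hist n \<omega>)))"
        if "W (hist n \<omega>) > 0" for n
        using elim(1) participation_eq[OF _ that] by (auto simp: length_hist add.commute)
      show "summable (\<lambda>n. ln (1 + 1 / W (hist n \<omega>)) * (of_bool (Lab j \<in> I (Suc n) \<omega>) - participation (hist n \<omega>)))"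
        using elim(4) unfolding log_increment_def .
    qed (use assms c(1) elim pos in auto)
  qed
qed

end

end

theorem theorem2p1:
  fixes M :: "'a measure" and N :: nat and p q r :: real
    and I :: "nat \<Rightarrow> 'a \<Rightarrow> vertex set" and j :: nat
  defines "\<alpha> \<equiv> interaction_alpha N p q r"
  assumes "N_interactions_model M N p q r I"
    and "\<alpha> > 0"
  shows "\<exists>\<gamma> :: 'a \<Rightarrow> real. \<gamma> \<in> borel_measurable M \<and> (\<forall>\<omega>\<in>space M. \<gamma> \<omega> > 0) \<and>
    (AE \<omega> in M. (\<lambda>n. real (vertex_weight N I n j \<omega>)) \<sim>[at_top]
       (\<lambda>n. 1 / Gamma (1 + \<alpha>) * \<gamma> \<omega> * real n powr \<alpha>))"
proof -
  interpret N_interactions_model M N p q r I by fact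
  define R where "R n \<omega> = real (vertex_weight N I n j \<omega>) / real n powr \<alpha>" for n \<omega>
  \<comment> \<open>Where the limit does not exist, \<open>lim\<close> is uncontrolled; the
    alternative 1 keeps \<gamma> positive on the whole space. The Gamma factor cancels the one in
    the claim.\<close>
  define \<gamma> where "\<gamma> \<omega> = (if lim (\<lambda>n. R n \<omega>) > 0 then Gamma (1 + \<alpha>) * lim (\<lambda>n. R n \<omega>) else 1)" for \<omega>
  have Gamma: "Gamma (1 + \<alpha>) > 0" using \<open>\<alpha> > 0\<close> by (intro Gamma_real_pos) simp
  have [measurable]: "R n \<in> borel_measurable M" for n
    unfolding R_def vertex_weight_eq
    by (rule measurable_hist_fun[of "\<lambda>h. real (weight (history_state N h) {Lab j}) / real n powr \<alpha>"])
  have "\<gamma> \<in> borel_measurable M"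
    unfolding \<gamma>_def by measurable
  moreover have "\<gamma> \<omega> > 0" for \<omega>
    using Gamma by (simp add: \<gamma>_def)
  moreover have "AE \<omega> in M. \<exists>L>0. (\<lambda>n. R n \<omega>) \<longlonglongrightarrow> L"
    using AE_vertex_weight_power_law \<open>\<alpha> > 0\<close> unfolding R_def \<alpha>_def by blast
  then have "AE \<omega> in M. (\<lambda>n. real (vertex_weight N I n j \<omega>)) \<sim>[at_top]
      (\<lambda>n. 1 / Gamma (1 + \<alpha>) * \<gamma> \<omega> * real n powr \<alpha>)"
  proof eventually_elim
    case (elim \<omega>)
    then obtain L where L: "L > 0" "(\<lambda>n. R n \<omega>) \<longlonglongrightarrow> L" by blast
    have "1 / Gamma (1 + \<alpha>) * \<gamma> \<omega> = L"
      using limI[OF L(2)] L(1) Gamma by (simp add: \<gamma>_def)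
    moreover have "(\<lambda>n. real (vertex_weight N I n j \<omega>)) \<sim>[at_top] (\<lambda>n. L * real n powr \<alpha>)"
    proof (rule asymp_equivI')
      have "(\<lambda>n. R n \<omega> / L) \<longlonglongrightarrow> L / L"
        using L by (intro tendsto_divide tendsto_const) auto
      then show "(\<lambda>n. real (vertex_weight N I n j \<omega>) / (L * real n powr \<alpha>)) \<longlonglongrightarrow> 1"
        using L(1) by (simp add: R_def mult.commute)
    qed
    ultimately show ?case by simp
  qed
  ultimately show ?thesis by blast
qed

end
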